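(* Let $\Omega\subset\mathbb R^n$ be a bounded domain, $n,N\ge1$. Let $f\colon\Omega\times\mathbb R^{N\times n}\to\mathbb R$ be such that $f(x,\xi)$ is $C^1$ in $\xi$ for a.e. $x\in\Omega$ and measurable in $x\in\Omega$ for all $\xi$, with $f(\cdot,0)\in L^1(\Omega)$, and let $A_f(x,\xi)=D_\xi f(x,\xi)$. Assume that $|A_f(x,\xi)|\le c_2(x)+c_3(\xi)$ for a.e. $x\in\Omega$ and all $\xi\in\mathbb R^{N\times n}$, where $c_2\in L^1(\Omega)$ and $c_3\in C(\mathbb R^{N\times n})$ are some positive functions. Suppose that $f$ is integral convex. Then for almost every $x_0\in\Omega$, the map $A_f(x_0,\cdot)\colon\mathbb R^{N\times n}\to\mathbb R^{N\times n}$ is quasimonotone in the sense that $$\int_GA_f(x_0,\xi+D\eta(y)):D\eta(y)\,dy\ge0\quad\forall\,\xi\in\mathbb R^{N\times n},\ \eta\in C_0^\infty(G;\mathbb R^N),$$ where $G$ is any nonempty bounded open set in $\mathbb R^n$. Therefore, for almost every $x_0\in\Omega$, the function $f(x_0,\cdot)\colon\mathbb R^{N\times n}\to\mathbb R$ is quasiconvex.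
   Context: $\mathbb R^{N\times n}$ carries the inner product $\xi:\eta=\operatorname{tr}(\xi^T\eta)$ and norm $|\xi|=(\xi:\xi)^{1/2}$; $Du=(\partial u^i/\partial x_j)$ is the Jacobian matrix of weak derivatives. The function $f$ is integral convex if the functional $\mathbf F(u)=\int_\Omega f(x,Du(x))\,dx$ is convex on $W_0^{1,\infty}(\Omega;\mathbb R^N)$. A function $h\colon\mathbb R^{N\times n}\to\mathbb R$ is (Morrey) quasiconvex if $\int_\Omega h(\xi+D\phi(x))\,dx\ge h(\xi)|\Omega|$ for all $\xi\in\mathbb R^{N\times n}$ and $\phi\in C_0^\infty(\Omega;\mathbb R^N)$. *)

theory Defs
  imports "HOL-Analysis.Analysis"
begin

text \<open>
  An \<open>N \<times> n\<close> matrix is an element of \<open>real^'n^'m\<close> with \<open>N = CARD('m)\<close>, \<open>n = CARD('n)\<close>.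
  The library inner product (hence the norm) on this type is the Frobenius one.
\<close>

lemma inner_matrix_eq_trace:
  fixes \<xi> \<eta> :: "real^'n^'m"
  shows "\<xi> \<bullet> \<eta> = trace (transpose \<xi> ** \<eta>)"
  unfolding inner_vec_def trace_def matrix_matrix_mult_def transpose_def
  by simp (rule sum.swap)

definition gradient :: "('a::real_inner \<Rightarrow> real) \<Rightarrow> 'a \<Rightarrow> 'a" where
  "gradient h \<xi> = (THE D. GDERIV h \<xi> :> D)"

definition C1_fun :: "('a::real_inner \<Rightarrow> real) \<Rightarrow> bool" where
  "C1_fun h \<longleftrightarrow> (\<forall>\<xi>. h differentiable (at \<xi>)) \<and> continuous_on UNIV (gradient h)"

fun Ck_fun :: "nat \<Rightarrow> ('a::real_normed_vector \<Rightarrow> 'b::real_normed_vector) \<Rightarrow> bool" where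
  "Ck_fun 0 u \<longleftrightarrow> continuous_on UNIV u"
| "Ck_fun (Suc k) u \<longleftrightarrow>
     (\<forall>x. u differentiable (at x)) \<and> (\<forall>v. Ck_fun k (\<lambda>x. frechet_derivative u (at x) v))"

text \<open>\<open>C\<^sub>0\<^sup>\<infinity>(G)\<close>, its members being regarded as functions on the whole space (extended by zero).\<close>

definition C0_inf :: "'a::real_normed_vector set \<Rightarrow> ('a \<Rightarrow> 'b::real_normed_vector) set" where
  "C0_inf G = {\<phi>. (\<forall>k. Ck_fun k \<phi>) \<and> compact (closure {x. \<phi> x \<noteq> 0}) \<and> closure {x. \<phi> x \<noteq> 0} \<subseteq> G}"

abbreviation Jac :: "(real^'n \<Rightarrow> real^'m) \<Rightarrow> real^'n \<Rightarrow> real^'n^'m" where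
  "Jac \<phi> x \<equiv> jacobian \<phi> (at x)"

definition weak_jacobian ::
    "(real^'n) set \<Rightarrow> (real^'n \<Rightarrow> real^'m) \<Rightarrow> (real^'n \<Rightarrow> real^'n^'m) \<Rightarrow> bool" where
  "weak_jacobian \<Omega> u U \<longleftrightarrow>
     (\<forall>K. compact K \<and> K \<subseteq> \<Omega> \<longrightarrow>
        integrable (lebesgue_on K) u \<and> integrable (lebesgue_on K) U) \<and>
     (\<forall>\<phi> \<in> C0_inf \<Omega>. \<forall>i j.
        (LINT x|lebesgue_on \<Omega>. u x $ i * frechet_derivative \<phi> (at x) (axis j 1)) =
        - (LINT x|lebesgue_on \<Omega>. U x $ i $ j * (\<phi> x :: real)))"

text \<open>The weak Jacobian is unique up to null sets; \<open>weak_D\<close> picks one representative.\<close>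

definition weak_D :: "(real^'n) set \<Rightarrow> (real^'n \<Rightarrow> real^'m) \<Rightarrow> real^'n \<Rightarrow> real^'n^'m" where
  "weak_D \<Omega> u = (SOME U. weak_jacobian \<Omega> u U)"

definition L_inf :: "(real^'n) set \<Rightarrow> (real^'n \<Rightarrow> 'b::euclidean_space) set" where
  "L_inf \<Omega> = {u. u \<in> borel_measurable (lebesgue_on \<Omega>) \<and>
                 (\<exists>C. AE x in lebesgue_on \<Omega>. norm (u x) \<le> C)}"

definition W_1_inf :: "(real^'n) set \<Rightarrow> (real^'n \<Rightarrow> real^'m) set" where
  "W_1_inf \<Omega> = {u. u \<in> L_inf \<Omega> \<and> (\<exists>U. weak_jacobian \<Omega> u U \<and> U \<in> L_inf \<Omega>)}"

text \<open>Closure of \<open>C\<^sub>0\<^sup>\<infinity>(\<Omega>; \<real>\<^sup>N)\<close> in \<open>W\<^sup>1\<^sup>,\<^sup>1(\<Omega>; \<real>\<^sup>N)\<close>.\<close>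

definition W0_1_1 :: "(real^'n) set \<Rightarrow> (real^'n \<Rightarrow> real^'m) set" where
  "W0_1_1 \<Omega> = {u. \<exists>U. weak_jacobian \<Omega> u U \<and>
     integrable (lebesgue_on \<Omega>) u \<and> integrable (lebesgue_on \<Omega>) U \<and>
     (\<exists>\<phi>. (\<forall>k. \<phi> k \<in> C0_inf \<Omega>) \<and>
        (\<lambda>k::nat. LINT x|lebesgue_on \<Omega>. norm (\<phi> k x - u x)) \<longlonglongrightarrow> 0 \<and>
        (\<lambda>k. LINT x|lebesgue_on \<Omega>. norm (Jac (\<phi> k) x - U x)) \<longlonglongrightarrow> 0)}"

text \<open>
  The usual convention \<open>W\<^sub>0\<^sup>1\<^sup>,\<^sup>\<infinity> = W\<^sup>1\<^sup>,\<^sup>\<infinity> \<inter> W\<^sub>0\<^sup>1\<^sup>,\<^sup>1\<close> of the calculus of variations, not the closure of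
  \<open>C\<^sub>0\<^sup>\<infinity>\<close> in the norm of \<open>W\<^sup>1\<^sup>,\<^sup>\<infinity>\<close> (which would contain only \<open>C\<^sup>1\<close> functions).
\<close>

definition W0_1_inf :: "(real^'n) set \<Rightarrow> (real^'n \<Rightarrow> real^'m) set" where
  "W0_1_inf \<Omega> = W_1_inf \<Omega> \<inter> W0_1_1 \<Omega>"

definition F_functional ::
    "(real^'n) set \<Rightarrow> (real^'n \<Rightarrow> real^'n^'m \<Rightarrow> real) \<Rightarrow> (real^'n \<Rightarrow> real^'m) \<Rightarrow> real" where
  "F_functional \<Omega> f u = (LINT x|lebesgue_on \<Omega>. f x (weak_D \<Omega> u x))"

text \<open>
  Convexity is spelled out because the library's \<open>convex_on\<close> needs a \<open>real_vector\<close> type,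
  which the function space is not.
\<close>

definition integral_convex :: "(real^'n) set \<Rightarrow> (real^'n \<Rightarrow> real^'n^'m \<Rightarrow> real) \<Rightarrow> bool" where
  "integral_convex \<Omega> f \<longleftrightarrow>
     (\<forall>u \<in> W0_1_inf \<Omega>. \<forall>v \<in> W0_1_inf \<Omega>. \<forall>t \<in> {0..1}.
        F_functional \<Omega> f (\<lambda>x. (1 - t) *\<^sub>R u x + t *\<^sub>R v x)
          \<le> (1 - t) * F_functional \<Omega> f u + t * F_functional \<Omega> f v)"

definition A_of :: "(real^'n \<Rightarrow> real^'n^'m \<Rightarrow> real) \<Rightarrow> real^'n \<Rightarrow> real^'n^'m \<Rightarrow> real^'n^'m" where
  "A_of f x \<xi> = gradient (f x) \<xi>"

definition quasimonotone :: "(real^'n^'m \<Rightarrow> real^'n^'m) \<Rightarrow> bool" where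
  "quasimonotone A \<longleftrightarrow>
     (\<forall>G::(real^'n) set. open G \<and> bounded G \<and> G \<noteq> {} \<longrightarrow>
        (\<forall>\<xi>. \<forall>\<eta> \<in> C0_inf G. 0 \<le> (LINT y|lebesgue_on G. A (\<xi> + Jac \<eta> y) \<bullet> Jac \<eta> y)))"

definition quasiconvex :: "(real^'n) set \<Rightarrow> (real^'n^'m \<Rightarrow> real) \<Rightarrow> bool" where
  "quasiconvex \<Omega> h \<longleftrightarrow>
     (\<forall>\<xi>. \<forall>\<phi> \<in> C0_inf \<Omega>.
        (LINT x|lebesgue_on \<Omega>. h (\<xi> + Jac \<phi> x)) \<ge> h \<xi> * measure lebesgue \<Omega>)"

end

theory Submission
  imports Defs
begin

text \<open>
  Convexity of the functional between \<open>u\<close> and \<open>u + w\<close> is tested with a compactly supported smooth \<open>u\<close>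
  whose gradient is \<open>\<xi>\<close> near \<open>x\<^sub>0\<close> and with \<open>w(x) = \<epsilon> \<eta>((x - x\<^sub>0)/\<epsilon>)\<close>. Rescaling and letting
  \<open>\<epsilon> \<rightarrow> 0\<close> shows, for almost every \<open>x\<^sub>0\<close> and with \<open>h = f(x\<^sub>0, \<cdot>)\<close>,
  that \<open>\<psi>(t) = \<integral> h(\<xi> + t D\<eta>) - h(\<xi>)\<close> lies below its chord on \<open>[0,1]\<close>.
  As \<open>\<psi>'(0) = D h(\<xi>) : \<integral> D\<eta> = 0\<close>, one gets \<open>\<psi>(1) \<ge> 0\<close>, which is quasiconvexity, and then
  \<open>\<psi>'(1) \<ge> \<psi>(1) - \<psi>(0) \<ge> 0\<close>, which is quasimonotonicity.

  The exceptional null set must not depend on \<open>\<xi>\<close>, \<open>\<eta>\<close>, \<open>t\<close>. Continuity of translations in \<open>L\<^sup>1\<close> gives one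
  sequence \<open>\<epsilon>\<^sub>k \<rightarrow> 0\<close> along which almost every point is a Lebesgue point of the countably many functions
  \<open>f(\<cdot>, \<zeta>)\<close>, \<open>\<zeta>\<close> in a dense set, and of the local Lipschitz bound of \<open>f(x, \<cdot>)\<close>;
  the Lipschitz bound then takes care of all \<open>\<zeta>\<close> at once.
\<close>

subsection \<open>Translations and affine maps in Lebesgue integrals\<close>

text \<open>Convexity is available only for functions that vanish at the boundary, so an affine u is
  not admissible. Cutting it off costs nothing: wherever Dw = 0 the three terms of the convexity
  inequality cancel, whatever Du is there. Only the ball where Du = \<xi> remains, and the localised
  inequality then holds for every sufficiently small \<epsilon>. This is why convergence along one
  sequence suffices: the sequence can be chosen so fast that the L^1 errors are summable.

  Two obstacles shape the rest. The hypotheses on f hold only almost everywhere, while the blow-up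
  evaluates f at moving points; so f is replaced by an integrand F that vanishes at the bad points
  and obeys all bounds everywhere. The functional is written with an arbitrarily chosen weak
  Jacobian, so its value on a test function is known only after weak Jacobians are shown to be
  unique almost everywhere. The same blow-up proves this, applied to a linear integrand tested
  against a rescaled bump.\<close>

lemma
  fixes t :: "'a::euclidean_space"
  assumes c: "c \<noteq> 0"
  shows lebesgue_affine: "lebesgue = density (distr lebesgue lebesgue (\<lambda>x. t + c *\<^sub>R x)) (\<lambda>_. \<bar>c\<bar> ^ DIM('a))"
    and measurable_lebesgue_affine: "(\<lambda>x. t + c *\<^sub>R x) \<in> lebesgue \<rightarrow>\<^sub>M lebesgue"
  \<comment> \<open>The cited facts treat maps with one factor per coordinate. With all factors
    equal to \<open>c\<close>, the coordinate sum collapses to a scaling and the product of the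
    factors to a power.\<close>
  using lebesgue_affine_euclidean[of "\<lambda>_. c" t] lebesgue_affine_measurable[of "\<lambda>_. c" t] c
  unfolding scaleR_scaleR[symmetric] scaleR_sum_right[symmetric] euclidean_representation prod_constant
  by simp_all

lemma
  fixes f :: "'a::euclidean_space \<Rightarrow> 'b::{banach, second_countable_topology}"
  assumes c: "c \<noteq> 0" and f: "integrable lebesgue f"
  shows integrable_lebesgue_affine: "integrable lebesgue (\<lambda>x. f (t + c *\<^sub>R x))"
    and integral_lebesgue_affine:
      "integral\<^sup>L lebesgue f = \<bar>c\<bar> ^ DIM('a) *\<^sub>R (LINT x|lebesgue. f (t + c *\<^sub>R x))"
proof -
  note meas [measurable] = measurable_lebesgue_affine[OF c, of t]
  have [measurable]: "f \<in> borel_measurable lebesgue" using f by auto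
  have "integrable (density (distr lebesgue lebesgue (\<lambda>x. t + c *\<^sub>R x)) (\<lambda>_. \<bar>c\<bar> ^ DIM('a))) f"
    using f unfolding lebesgue_affine[OF c, of t, symmetric] .
  then have "integrable lebesgue (\<lambda>x. \<bar>c\<bar> ^ DIM('a) *\<^sub>R f (t + c *\<^sub>R x))"
    by (subst (asm) integrable_density) (auto simp: integrable_distr_eq)
  from integrable_scaleR_right[OF this, of "inverse (\<bar>c\<bar> ^ DIM('a))"]
  show "integrable lebesgue (\<lambda>x. f (t + c *\<^sub>R x))"
    using c by simp
  have "integral\<^sup>L lebesgue f
      = integral\<^sup>L (density (distr lebesgue lebesgue (\<lambda>x. t + c *\<^sub>R x)) (\<lambda>_. \<bar>c\<bar> ^ DIM('a))) f"
    unfolding lebesgue_affine[OF c, of t, symmetric] ..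
  also have "\<dots> = \<bar>c\<bar> ^ DIM('a) *\<^sub>R (LINT x|lebesgue. f (t + c *\<^sub>R x))"
    by (subst integral_density) (auto simp: integral_distr)
  finally show "integral\<^sup>L lebesgue f = \<bar>c\<bar> ^ DIM('a) *\<^sub>R (LINT x|lebesgue. f (t + c *\<^sub>R x))" .
qed

text \<open>The image of Lebesgue measure differs from it by a nonzero constant density, so both
  have the same null sets.\<close>

lemma AE_lebesgue_affine:
  fixes t :: "'a::euclidean_space"
  assumes c: "c \<noteq> 0" and P: "AE x in lebesgue. P x"
  shows "AE x in lebesgue. P (t + c *\<^sub>R x)"
proof -
  have "AE x in density (distr lebesgue lebesgue (\<lambda>x. t + c *\<^sub>R x)) (\<lambda>_. \<bar>c\<bar> ^ DIM('a)). P x"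
    using P unfolding lebesgue_affine[OF c, of t, symmetric] .
  then have "AE x in distr lebesgue lebesgue (\<lambda>x. t + c *\<^sub>R x). P x"
    using c by (subst (asm) AE_density) auto
  then show ?thesis
    by (rule AE_distrD[OF measurable_lebesgue_affine[OF c]])
qed

lemma nn_integral_lborel_translate:
  fixes h :: "'a::euclidean_space"
  assumes "f \<in> borel_measurable borel"
  shows "(\<integral>\<^sup>+x. f (x + h) \<partial>lborel) = (\<integral>\<^sup>+x. f x \<partial>lborel)"
proof -
  have "(\<integral>\<^sup>+x. f x \<partial>lborel) = (\<integral>\<^sup>+x. f x \<partial>distr lborel borel ((+) h))"
    by (simp add: lborel_distr_plus)
  also have "\<dots> = (\<integral>\<^sup>+x. f (x + h) \<partial>lborel)"
    using assms by (subst nn_integral_distr) (auto simp: add.commute)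
  finally show ?thesis ..
qed

section \<open>Continuity of translations in L^1\<close>

lemma compact_open_sandwich:
  fixes A :: "'a::euclidean_space set"
  assumes A: "A \<in> sets lborel" "emeasure lborel A < \<infinity>" and e: "e > 0"
  obtains K U where "compact K" "open U" "K \<subseteq> A" "A \<subseteq> U" "emeasure lborel (U - K) \<le> ennreal e"
proof -
  obtain U where U: "open U" "A \<subseteq> U" "emeasure lborel (U - A) < ennreal (e/3)"
    using outer_regular_lborel[of A "e/3"] A e by auto
  have Al: "A \<in> sets lebesgue" using A by auto
  obtain T where T: "closed T" "T \<subseteq> A" "A - T \<in> lmeasurable" "emeasure lebesgue (A - T) < ennreal (e/3)"
    using sets_lebesgue_inner_closed[OF Al, of "e/3"] e by auto
  \<comment> \<open>Regularity gives an open set outside and a closed set inside. Compactness comes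
    from truncating by a large ball, which loses little because \<open>A\<close> has finite measure.
    The three errors get a third of \<open>e\<close> each.\<close>
  have dec: "decseq (\<lambda>n::nat. A - cball 0 (real n))"
    by (auto simp: decseq_def)
  have "(\<lambda>n. emeasure lborel (A - cball 0 (real n))) \<longlonglongrightarrow> emeasure lborel (\<Inter>n. A - cball 0 (real n))"
  proof (rule Lim_emeasure_decseq[OF _ dec])
    show "range (\<lambda>n. A - cball 0 (real n)) \<subseteq> sets lborel"
      using A by auto
    show "emeasure lborel (A - cball 0 (real n)) \<noteq> \<infinity>" for n
    proof -
      have "emeasure lborel (A - cball 0 (real n)) \<le> emeasure lborel A"
        by (rule emeasure_mono) (use A in auto)
      also have "\<dots> < \<infinity>" by (rule A)
      finally show ?thesis by auto
    qed
  qed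
  also have "(\<Inter>n. A - cball 0 (real n)) = {}"
    by (auto simp: real_arch_simple)
  finally have "(\<lambda>n. emeasure lborel (A - cball 0 (real n))) \<longlonglongrightarrow> 0" by simp
  then have "\<forall>\<^sub>F n in sequentially. emeasure lborel (A - cball 0 (real n)) < ennreal (e/3)"
    using e by (intro order_tendstoD) auto
  then obtain n where n: "emeasure lborel (A - cball 0 (real n)) < ennreal (e/3)"
    by (auto simp: eventually_sequentially)
  define K where "K = T \<inter> cball 0 (real n)"
  have "emeasure lborel (U - K) \<le> emeasure lborel ((U - A) \<union> ((A - T) \<union> (A - cball 0 (real n))))"
    by (rule emeasure_mono) (use A U T in \<open>auto simp: K_def\<close>)
  also have "\<dots> \<le> emeasure lborel (U - A) + (emeasure lborel (A - T) + emeasure lborel (A - cball 0 (real n)))"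
    by (intro order_trans[OF emeasure_subadditive] add_mono order_refl) (use A U T in auto)
  also have "\<dots> \<le> ennreal (e/3) + (ennreal (e/3) + ennreal (e/3))"
  proof (intro add_mono)
    show "emeasure lborel (A - T) \<le> ennreal (e/3)"
      using T A by simp
  qed (use U n in auto)
  also have "\<dots> = ennreal e"
    using e by (simp flip: ennreal_plus)
  finally have "emeasure lborel (U - K) \<le> ennreal e" .
  moreover have "compact K" unfolding K_def using T by (simp add: closed_Int_compact)
  ultimately show ?thesis using that U T by (auto simp: K_def)
qed

text \<open>Induction over integrable functions: indicators, sums, pointwise dominated limits. The
  nonnegative integral makes sense before any integrability of the translates is known.\<close>

lemma continuous_translation_L1:
  fixes g :: "'a::euclidean_space \<Rightarrow> real"
  assumes "integrable lborel g" "e > 0"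
  shows "\<exists>d>0. \<forall>h. norm h < d \<longrightarrow> (\<integral>\<^sup>+x. ennreal \<bar>g (x + h) - g x\<bar> \<partial>lborel) \<le> ennreal e"
  using assms
proof (induction arbitrary: e rule: integrable_induct)
  case (base A c)
  \<comment> \<open>The error of the sandwich enters twice, at x and at x + h, each time with the
    factor \<open>\<bar>c\<bar>\<close>. The added 1 avoids a division by zero for
    \<open>c = 0\<close>.\<close>
  define e' where "e' = e / (2 * (\<bar>c\<bar> + 1))"
  have e': "e' > 0" using base by (auto simp: e'_def)
  obtain K U where KU: "compact K" "open U" "K \<subseteq> A" "A \<subseteq> U" "emeasure lborel (U - K) \<le> ennreal e'"
    using compact_open_sandwich[OF base(1,2) e'] by auto
  obtain d where d: "d > 0" "(\<Union>x\<in>K. ball x d) \<subseteq> U"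
    using compact_subset_open_imp_ball_epsilon_subset[of K U] KU by auto
  have "(\<integral>\<^sup>+x. ennreal \<bar>indicat_real A (x + h) *\<^sub>R c - indicat_real A x *\<^sub>R c\<bar> \<partial>lborel) \<le> ennreal e"
    if h: "norm h < d" for h
  proof -
    have Um: "U - K \<in> sets borel" using KU by (simp add: compact_imp_closed)
    \<comment> \<open>A shift shorter than \<open>d\<close> cannot carry a point of \<open>K\<close>
      out of \<open>U\<close>. So if the indicator of \<open>A\<close> differs at x and x + h, at
      least one of the two points lies in \<open>U - K\<close>.\<close>
    have *: "x \<in> U" if "x + h \<in> K \<or> x - h \<in> K" for x
      using that d(2) h by (auto simp: subset_eq dist_norm norm_minus_commute)
    have "ennreal \<bar>indicat_real A (x + h) *\<^sub>R c - indicat_real A x *\<^sub>R c\<bar>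
        \<le> ennreal \<bar>c\<bar> * (indicator (U - K) (x + h) + indicator (U - K) x)" for x
    proof -
      have "\<bar>indicat_real A (x + h) *\<^sub>R c - indicat_real A x *\<^sub>R c\<bar>
        \<le> \<bar>c\<bar> * (indicat_real (U - K) (x + h) + indicat_real (U - K) x)"
        using KU(3,4) *[of x] *[of "x + h"] by (auto simp: indicator_def)
      then have "ennreal \<bar>indicat_real A (x + h) *\<^sub>R c - indicat_real A x *\<^sub>R c\<bar>
        \<le> ennreal (\<bar>c\<bar> * (indicat_real (U - K) (x + h) + indicat_real (U - K) x))"
        by (rule ennreal_leI)
      also have "\<dots> = ennreal \<bar>c\<bar> * (indicator (U - K) (x + h) + indicator (U - K) x)"
        by (simp only: ennreal_mult'[OF abs_ge_zero] ennreal_plus[OF indicator_pos_le indicator_pos_le] ennreal_indicator)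
      finally show ?thesis .
    qed
    then have "(\<integral>\<^sup>+x. ennreal \<bar>indicat_real A (x + h) *\<^sub>R c - indicat_real A x *\<^sub>R c\<bar> \<partial>lborel)
       \<le> (\<integral>\<^sup>+x. ennreal \<bar>c\<bar> * (indicator (U - K) (x + h) + indicator (U - K) x) \<partial>lborel)"
      by (intro nn_integral_mono)
    also have "\<dots> = ennreal \<bar>c\<bar> * (emeasure lborel (U - K) + emeasure lborel (U - K))"
      using Um by (simp add: nn_integral_cmult nn_integral_add
          nn_integral_lborel_translate[of "indicator (U - K)" h])
    also have "\<dots> \<le> ennreal \<bar>c\<bar> * (ennreal e' + ennreal e')"
      by (intro mult_left_mono add_mono KU) auto
    also have "\<dots> = ennreal (\<bar>c\<bar> * (e' + e'))"
      using e' by (simp add: ennreal_mult' flip: ennreal_plus)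
    also have "\<dots> \<le> ennreal e"
    proof (rule ennreal_leI)
      have "e = (\<bar>c\<bar> + 1) * (e' + e')"
        using abs_ge_zero[of c] unfolding e'_def by (simp add: divide_simps)
      then show "\<bar>c\<bar> * (e' + e') \<le> e" using e' by (simp add: algebra_simps)
    qed
    finally show ?thesis .
  qed
  then show ?case using d by blast
next
  case (add f g)
  from add.IH(1)[of "e/2"] add.IH(2)[of "e/2"] add.prems obtain d1 d2 where
    d: "d1 > 0" "d2 > 0" "\<And>h. norm h < d1 \<Longrightarrow> (\<integral>\<^sup>+x. ennreal \<bar>f (x + h) - f x\<bar> \<partial>lborel) \<le> ennreal (e/2)"
       "\<And>h. norm h < d2 \<Longrightarrow> (\<integral>\<^sup>+x. ennreal \<bar>g (x + h) - g x\<bar> \<partial>lborel) \<le> ennreal (e/2)"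
    by fastforce
  have [measurable]: "f \<in> borel_measurable borel" "g \<in> borel_measurable borel"
    using add.hyps by auto
  show ?case
  proof (intro exI[of _ "min d1 d2"] conjI allI impI)
    fix h :: 'a assume h: "norm h < min d1 d2"
    have "(\<integral>\<^sup>+x. ennreal \<bar>f (x + h) + g (x + h) - (f x + g x)\<bar> \<partial>lborel)
       \<le> (\<integral>\<^sup>+x. ennreal \<bar>f (x + h) - f x\<bar> + ennreal \<bar>g (x + h) - g x\<bar> \<partial>lborel)"
      by (intro nn_integral_mono) (auto simp flip: ennreal_plus intro!: ennreal_leI)
    also have "\<dots> = (\<integral>\<^sup>+x. ennreal \<bar>f (x + h) - f x\<bar> \<partial>lborel) + (\<integral>\<^sup>+x. ennreal \<bar>g (x + h) - g x\<bar> \<partial>lborel)"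
      by (intro nn_integral_add) auto
    also have "\<dots> \<le> ennreal (e/2) + ennreal (e/2)"
      using h by (intro add_mono d) auto
    also have "\<dots> = ennreal e" using add.prems by (simp flip: ennreal_plus)
    finally show "(\<integral>\<^sup>+x. ennreal \<bar>f (x + h) + g (x + h) - (f x + g x)\<bar> \<partial>lborel) \<le> ennreal e" .
  qed (use d in auto)
next
  case (lim f s)
  have [measurable]: "f \<in> borel_measurable borel" "\<And>i. s i \<in> borel_measurable borel"
    using lim.hyps by auto
  have "(\<lambda>i. \<integral>\<^sup>+x. norm (f x - s i x) \<partial>lborel) \<longlonglongrightarrow> 0"
  proof (rule nn_integral_dominated_convergence_norm[where w = "\<lambda>x. 2 * norm (f x)"])
    show "(\<integral>\<^sup>+x. ennreal (2 * norm (f x)) \<partial>lborel) < \<infinity>"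
    proof -
      have "integrable lborel (\<lambda>x. 2 * norm (f x))" using lim.hyps by auto
      from integrableD(2)[OF this] show ?thesis by (simp add: less_top)
    qed
  qed (use lim.hyps in auto)
  then have "\<forall>\<^sub>F i in sequentially. (\<integral>\<^sup>+x. norm (f x - s i x) \<partial>lborel) < ennreal (e/3)"
    using lim.prems by (intro order_tendstoD) auto
  then obtain i where i: "(\<integral>\<^sup>+x. ennreal \<bar>f x - s i x\<bar> \<partial>lborel) < ennreal (e/3)"
    by (auto simp: eventually_sequentially)
  obtain d where d: "d > 0"
    "\<And>h. norm h < d \<Longrightarrow> (\<integral>\<^sup>+x. ennreal \<bar>s i (x + h) - s i x\<bar> \<partial>lborel) \<le> ennreal (e/3)"
    using lim.IH[of "e/3" i] lim.prems by auto
  show ?case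
  proof (intro exI[of _ d] conjI allI impI)
    \<comment> \<open>The approximant \<open>s i\<close> is inserted both at x + h and at x; by
      translation invariance the two approximation errors have the same integral.\<close>
    fix h :: 'a assume h: "norm h < d"
    have "(\<integral>\<^sup>+x. ennreal \<bar>f (x + h) - f x\<bar> \<partial>lborel)
       \<le> (\<integral>\<^sup>+x. ennreal \<bar>f (x + h) - s i (x + h)\<bar> + (ennreal \<bar>s i (x + h) - s i x\<bar> + ennreal \<bar>f x - s i x\<bar>) \<partial>lborel)"
      by (intro nn_integral_mono) (auto simp flip: ennreal_plus intro!: ennreal_leI)
    also have "\<dots> = (\<integral>\<^sup>+x. ennreal \<bar>f (x + h) - s i (x + h)\<bar> \<partial>lborel) +
       ((\<integral>\<^sup>+x. ennreal \<bar>s i (x + h) - s i x\<bar> \<partial>lborel) + (\<integral>\<^sup>+x. ennreal \<bar>f x - s i x\<bar> \<partial>lborel))"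
      by (subst nn_integral_add; (subst nn_integral_add)?) auto
    also have "(\<integral>\<^sup>+x. ennreal \<bar>f (x + h) - s i (x + h)\<bar> \<partial>lborel) = (\<integral>\<^sup>+x. ennreal \<bar>f x - s i x\<bar> \<partial>lborel)"
      by (rule nn_integral_lborel_translate[of "\<lambda>x. ennreal \<bar>f x - s i x\<bar>"]) auto
    also have "\<dots> + ((\<integral>\<^sup>+x. ennreal \<bar>s i (x + h) - s i x\<bar> \<partial>lborel) + (\<integral>\<^sup>+x. ennreal \<bar>f x - s i x\<bar> \<partial>lborel))
       \<le> ennreal (e/3) + (ennreal (e/3) + ennreal (e/3))"
      using i h by (intro add_mono d) auto
    also have "\<dots> = ennreal e" using lim.prems by (simp flip: ennreal_plus)
    finally show "(\<integral>\<^sup>+x. ennreal \<bar>f (x + h) - f x\<bar> \<partial>lborel) \<le> ennreal e" .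
  qed (use d in auto)
qed

subsection \<open>Blow-up at almost every point\<close>

lemma ennreal_suminf_finite_imp_tendsto_0:
  fixes a :: "nat \<Rightarrow> ennreal"
  assumes "(\<Sum>k. a k) \<noteq> \<infinity>"
  shows "a \<longlonglongrightarrow> 0"
proof -
  have fin: "a k \<noteq> top" for k
  proof -
    have "a k \<le> (\<Sum>k. a k)"
      using sum_le_suminf[of a "{k}"] by auto
    then show ?thesis using assms by (auto simp: top_unique)
  qed
  then have a: "a = (\<lambda>k. ennreal (enn2real (a k)))" by (auto simp: ennreal_enn2real_if)
  then have "summable (\<lambda>k. enn2real (a k))"
    using assms by (intro summable_suminf_not_top) auto
  then have "(\<lambda>k. ennreal (enn2real (a k))) \<longlonglongrightarrow> ennreal 0"
    by (intro tendsto_ennrealI summable_LIMSEQ_zero)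
  then show ?thesis using a by simp
qed

text \<open>A Borel-Cantelli argument. If the translations by \<open>\<epsilon> k\<close> times y
  move each \<open>g i\<close> by at most 2^-k in L^1, uniformly for y in a ball, then Tonelli makes
  the x-integrals of the blow-up errors summable in k; so for almost every x the errors themselves
  are summable and tend to 0.\<close>

lemma AE_blow_up_borel:
  fixes g :: "nat \<Rightarrow> 'a::euclidean_space \<Rightarrow> real"
  assumes g: "\<And>i. integrable lborel (g i)"
  obtains \<epsilon> where "\<And>k. 0 < \<epsilon> k" "\<epsilon> \<longlonglongrightarrow> 0"
    "AE x in lborel. \<forall>i r::nat. (\<lambda>k. \<integral>\<^sup>+y. indicator (cball 0 (real r)) y *
        ennreal \<bar>g i (x + \<epsilon> k *\<^sub>R y) - g i x\<bar> \<partial>lborel) \<longlonglongrightarrow> 0"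
proof -
  define T where "T i h = (\<integral>\<^sup>+x. ennreal \<bar>g i (x + h) - g i x\<bar> \<partial>lborel)" for i h
  have [measurable]: "g i \<in> borel_measurable borel" for i using g[of i] by auto
  have "\<forall>i k::nat. \<exists>d>0. \<forall>h. norm h < d \<longrightarrow> T i h \<le> ennreal ((1/2)^k)"
    unfolding T_def by (intro allI continuous_translation_L1 g) auto
  then obtain d where d: "\<And>i k. d i k > (0::real)"
      "\<And>i k h. norm h < d i k \<Longrightarrow> T i h \<le> ennreal ((1/2)^k)"
    by metis
  \<comment> \<open>Diagonal choice: step k takes care of all indices i up to k and all y with norm
    up to k. The factor 1 / (k + 1) brings the translation by \<open>\<epsilon> k\<close> times such
    a y strictly below \<open>d i k\<close>. The separate entry forces \<open>\<epsilon>\<close> to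
    tend to 0.\<close>
  define \<epsilon> where "\<epsilon> k = Min (insert (1 / (real k + 1)) ((\<lambda>i. d i k / (real k + 1)) ` {..k}))" for k :: nat
  have pos: "0 < \<epsilon> k" for k using d(1) by (auto simp: \<epsilon>_def)
  have le1: "\<epsilon> k \<le> 1 / (real k + 1)" for k unfolding \<epsilon>_def by (intro Min_le) auto
  have led: "\<epsilon> k \<le> d i k / (real k + 1)" if "i \<le> k" for i k
    unfolding \<epsilon>_def by (intro Min_le) (use that in auto)
  have lim: "\<epsilon> \<longlonglongrightarrow> 0"
  proof (rule tendsto_sandwich[OF _ _ tendsto_const])
    show "(\<lambda>k. 1 / (real k + 1)) \<longlonglongrightarrow> 0"
      using LIMSEQ_inverse_real_of_nat by (simp add: inverse_eq_divide add.commute)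
  qed (use pos le1 in \<open>auto intro: always_eventually less_imp_le\<close>)
  have small: "T i (\<epsilon> k *\<^sub>R y) \<le> ennreal ((1/2)^k)" if "i \<le> k" "r \<le> k" "y \<in> cball 0 (real r)" for i k r y
  proof (rule d(2))
    have "norm (\<epsilon> k *\<^sub>R y) \<le> (d i k / (real k + 1)) * real k"
    proof -
      have "\<epsilon> k * norm y \<le> (d i k / (real k + 1)) * real k"
        using pos[of k] led[OF that(1)] that(2,3) d(1)[of i k] by (intro mult_mono) auto
      then show ?thesis using pos[of k] by simp
    qed
    also have "\<dots> < d i k" using d(1)[of i k] by (simp add: field_simps)
    finally show "norm (\<epsilon> k *\<^sub>R y) < d i k" .
  qed
  define J where "J i r k x = (\<integral>\<^sup>+y. indicator (cball 0 (real r)) y *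
        ennreal \<bar>g i (x + \<epsilon> k *\<^sub>R y) - g i x\<bar> \<partial>lborel)" for i r k x
  \<comment> \<open>Tonelli asks for joint measurability in x and y, which is why Borel functions
    are treated before Lebesgue measurable ones.\<close>
  have jm: "(\<lambda>p. indicator (cball 0 (real r)) (snd p) * ennreal \<bar>g i (fst p + \<epsilon> k *\<^sub>R snd p) - g i (fst p)\<bar>)
      \<in> borel_measurable (lborel \<Otimes>\<^sub>M lborel)" for i r k
  proof -
    have [measurable]: "(\<lambda>p. indicator (cball 0 (real r)) (snd p :: 'a) :: ennreal) \<in> borel_measurable (borel \<Otimes>\<^sub>M borel :: ('a \<times> 'a) measure)"
      by (intro measurable_compose[OF measurable_snd] borel_measurable_indicator) simp
    have [measurable]: "(\<lambda>p. fst p + \<epsilon> k *\<^sub>R snd p :: 'a) \<in> borel_measurable (borel \<Otimes>\<^sub>M borel)"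
      by measurable
    have "(\<lambda>p. indicator (cball 0 (real r)) (snd p) * ennreal \<bar>g i (fst p + \<epsilon> k *\<^sub>R snd p) - g i (fst p)\<bar>)
      \<in> borel_measurable (borel \<Otimes>\<^sub>M borel)"
      by measurable
    then show ?thesis
      by (subst measurable_cong_sets[OF sets_pair_measure_cong[OF sets_lborel sets_lborel] refl])
  qed
  have [measurable]: "J i r k \<in> borel_measurable lborel" for i r k
    unfolding J_def by (rule lborel.borel_measurable_nn_integral) (use jm[of r i k] in \<open>simp add: split_beta'\<close>)
  have J_le: "(\<integral>\<^sup>+x. J i r k x \<partial>lborel) \<le> ennreal (measure lborel (cball (0::'a) r) * (1/2)^k)"
    if "i \<le> k" "r \<le> k" for i r k
  proof -
    have "(\<integral>\<^sup>+x. J i r k x \<partial>lborel) = (\<integral>\<^sup>+y. \<integral>\<^sup>+x. indicator (cball 0 (real r)) y *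
        ennreal \<bar>g i (x + \<epsilon> k *\<^sub>R y) - g i x\<bar> \<partial>lborel \<partial>lborel)"
      unfolding J_def by (rule lborel_pair.Fubini'[symmetric]) (use jm[of r i k] in \<open>simp add: split_beta'\<close>)
    also have "\<dots> = (\<integral>\<^sup>+y. indicator (cball 0 (real r)) y * T i (\<epsilon> k *\<^sub>R y) \<partial>lborel)"
      unfolding T_def by (rule nn_integral_cong, rule nn_integral_cmult) measurable
    also have "\<dots> \<le> (\<integral>\<^sup>+y. ennreal ((1/2)^k) * indicator (cball (0::'a) (real r)) y \<partial>lborel)"
    proof (rule nn_integral_mono)
      fix y :: 'a
      show "indicator (cball 0 (real r)) y * T i (\<epsilon> k *\<^sub>R y) \<le> ennreal ((1/2)^k) * indicator (cball 0 (real r)) y"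
        using small[OF that, of y] by (cases "y \<in> cball 0 (real r)") simp_all
    qed
    also have "\<dots> = ennreal ((1/2)^k) * emeasure lborel (cball (0::'a) r)"
      by (subst nn_integral_cmult_indicator) auto
    also have "\<dots> = ennreal (measure lborel (cball (0::'a) r) * (1/2)^k)"
    proof -
      have "emeasure lborel (cball (0::'a) r) \<noteq> top"
        using emeasure_lborel_cball_finite[of "0::'a" "real r"] by auto
      from emeasure_eq_ennreal_measure[OF this] show ?thesis
        by (simp only: ennreal_mult'[OF measure_nonneg] mult.commute)
    qed
    finally show ?thesis .
  qed
  have "AE x in lborel. (\<lambda>k. J i r k x) \<longlonglongrightarrow> 0" for i r
  proof -
    \<comment> \<open>The geometric bound holds only once k has passed both i and r, so the series
      starts at \<open>m\<close>; the limit is not affected.\<close>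
    define m where "m = max i r"
    have "(\<integral>\<^sup>+x. (\<Sum>k. J i r (k + m) x) \<partial>lborel) = (\<Sum>k. \<integral>\<^sup>+x. J i r (k + m) x \<partial>lborel)"
      by (rule nn_integral_suminf) measurable
    also have "\<dots> \<le> (\<Sum>k. ennreal (measure lborel (cball (0::'a) r) * (1/2)^(k + m)))"
      by (rule suminf_le[OF _ summableI summableI], rule J_le) (simp_all add: m_def)
    also have "\<dots> < \<infinity>"
    proof -
      have "summable (\<lambda>k. measure lborel (cball (0::'a) r) * (1/2::real)^(k + m))"
        by (intro summable_mult summable_ignore_initial_segment summable_geometric) auto
      then have "(\<Sum>k. ennreal (measure lborel (cball (0::'a) r) * (1/2)^(k + m))) \<noteq> top"
        by (rule ennreal_suminf_neq_top) simp
      then show ?thesis by (simp only: less_top infinity_ennreal_def)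
    qed
    finally have fin: "(\<integral>\<^sup>+x. (\<Sum>k. J i r (k + m) x) \<partial>lborel) \<noteq> \<infinity>"
      by (rule less_imp_neq)
    have "AE x in lborel. (\<Sum>k. J i r (k + m) x) \<noteq> \<infinity>"
      by (rule nn_integral_noteq_infinite[OF _ fin]) measurable
    then show ?thesis
      by eventually_elim (rule LIMSEQ_offset[where k = m], rule ennreal_suminf_finite_imp_tendsto_0)
  qed
  then have "AE x in lborel. \<forall>i r. (\<lambda>k. J i r k x) \<longlonglongrightarrow> 0"
    by (simp only: AE_all_countable simp_thms)
  then show ?thesis unfolding J_def by (rule that[OF pos lim])
qed

text \<open>Each \<open>g i\<close> agrees almost everywhere with a Borel function. Scaling and
  translating preserve null sets, so the blown-up functions also agree for almost every y. At the
  centre x, equality is needed at the point itself, which excludes one more null set.\<close>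

lemma AE_blow_up:
  fixes g :: "nat \<Rightarrow> 'a::euclidean_space \<Rightarrow> real"
  assumes g: "\<And>i. integrable lebesgue (g i)"
  obtains \<epsilon> where "\<And>k. 0 < \<epsilon> k" "\<epsilon> \<longlonglongrightarrow> 0"
    "AE x in lebesgue. \<forall>i r::nat. (\<lambda>k. LINT y|lebesgue. indicator (cball 0 (real r)) y *
        \<bar>g i (x + \<epsilon> k *\<^sub>R y) - g i x\<bar>) \<longlonglongrightarrow> 0"
proof -
  have "\<exists>g'. g' \<in> borel_measurable borel \<and> (AE x in lborel. g i x = g' x)" for i
    using completion_ex_borel_measurable_real[OF borel_measurable_integrable[OF g[of i]]]
    by auto
  then have "\<exists>g'. \<forall>i. g' i \<in> borel_measurable borel \<and> (AE x in lborel. g i x = g' i x)"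
    by (intro choice allI)
  then obtain g' where g' [measurable]: "\<And>i. g' i \<in> borel_measurable borel"
      and eq: "\<And>i. AE x in lborel. g i x = g' i x"
    by blast
  have int': "integrable lborel (g' i)" for i
  proof -
    have "integrable lebesgue (g' i)"
      by (rule integrable_cong_AE_imp[OF g[of i]]) (simp_all add: AE_completion[OF eq[of i]] measurable_completion)
    then show ?thesis by (simp add: integrable_completion)
  qed
  obtain \<epsilon> where \<epsilon>: "\<And>k. 0 < \<epsilon> k" "\<epsilon> \<longlonglongrightarrow> 0"
    and lim: "AE x in lborel. \<forall>i r::nat. (\<lambda>k. \<integral>\<^sup>+y. indicator (cball 0 (real r)) y *
        ennreal \<bar>g' i (x + \<epsilon> k *\<^sub>R y) - g' i x\<bar> \<partial>lborel) \<longlonglongrightarrow> 0"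
    by (rule AE_blow_up_borel[where g = g', OF int'], rule that)
  have eq': "AE x in lebesgue. \<forall>i. g i x = g' i x"
    unfolding AE_all_countable using eq by (intro allI AE_completion)
  have "AE x in lebesgue. \<forall>i r::nat. (\<lambda>k. LINT y|lebesgue. indicator (cball 0 (real r)) y *
        \<bar>g i (x + \<epsilon> k *\<^sub>R y) - g i x\<bar>) \<longlonglongrightarrow> 0"
    using AE_completion[OF lim] eq'
  proof eventually_elim
    case (elim x)
    show ?case
    proof (intro allI)
      fix i r :: nat
      have "(LINT y|lebesgue. indicator (cball 0 (real r)) y * \<bar>g i (x + \<epsilon> k *\<^sub>R y) - g i x\<bar>)
         = enn2real (\<integral>\<^sup>+y. indicator (cball 0 (real r)) y *
        ennreal \<bar>g' i (x + \<epsilon> k *\<^sub>R y) - g' i x\<bar> \<partial>lborel)" for k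
      proof -
        have AE_eq: "AE y in lebesgue. \<forall>i. g i (x + \<epsilon> k *\<^sub>R y) = g' i (x + \<epsilon> k *\<^sub>R y)"
          using \<epsilon>(1)[of k] by (intro AE_lebesgue_affine eq') auto
        have gm: "(\<lambda>y. g i (x + \<epsilon> k *\<^sub>R y)) \<in> borel_measurable lebesgue"
          using \<epsilon>(1)[of k] g[of i] by (intro borel_measurable_affine) auto
        have g'm: "(\<lambda>y. g' i (x + \<epsilon> k *\<^sub>R y)) \<in> borel_measurable lebesgue"
          by (intro measurable_completion) simp
        have indm: "(\<lambda>y. indicat_real (cball 0 (real r)) y * \<bar>h y - t\<bar>) \<in> borel_measurable lebesgue"
          if "h \<in> borel_measurable lebesgue" for h :: "'a \<Rightarrow> real" and t
          using that by (intro borel_measurable_times borel_measurable_indicator borel_measurable_abs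
              borel_measurable_diff borel_measurable_const) auto
        have "(LINT y|lebesgue. indicator (cball 0 (real r)) y * \<bar>g i (x + \<epsilon> k *\<^sub>R y) - g i x\<bar>)
          = (LINT y|lebesgue. indicator (cball 0 (real r)) y * \<bar>g' i (x + \<epsilon> k *\<^sub>R y) - g' i x\<bar>)"
          using AE_eq by (intro integral_cong_AE indm gm g'm) (use elim(2) in \<open>auto elim!: eventually_mono\<close>)
        also have "\<dots> = enn2real (\<integral>\<^sup>+y. ennreal (indicator (cball 0 (real r)) y *
             \<bar>g' i (x + \<epsilon> k *\<^sub>R y) - g' i x\<bar>) \<partial>lebesgue)"
          by (rule integral_eq_nn_integral[OF indm[OF g'm]]) simp
        also have "(\<integral>\<^sup>+y. ennreal (indicator (cball 0 (real r)) y *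
             \<bar>g' i (x + \<epsilon> k *\<^sub>R y) - g' i x\<bar>) \<partial>lebesgue) =
           (\<integral>\<^sup>+y. indicator (cball 0 (real r)) y * ennreal \<bar>g' i (x + \<epsilon> k *\<^sub>R y) - g' i x\<bar> \<partial>lborel)"
          unfolding nn_integral_completion
          by (intro nn_integral_cong) (simp add: indicator_def)
        finally show ?thesis .
      qed
      moreover have "(\<lambda>k. enn2real (\<integral>\<^sup>+y. indicator (cball 0 (real r)) y *
        ennreal \<bar>g' i (x + \<epsilon> k *\<^sub>R y) - g' i x\<bar> \<partial>lborel)) \<longlonglongrightarrow> enn2real (ennreal 0)"
        using elim(1) by (intro tendsto_enn2real) simp_all
      ultimately show "(\<lambda>k. LINT y|lebesgue. indicator (cball 0 (real r)) y *
        \<bar>g i (x + \<epsilon> k *\<^sub>R y) - g i x\<bar>) \<longlonglongrightarrow> 0" by simp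
    qed
  qed
  then show ?thesis by (rule that[OF \<epsilon>])
qed

section \<open>Integrands measurable in x and continuous in the second variable\<close>

lemma borel_measurable_caratheodory:
  fixes F :: "'a \<Rightarrow> 'b::{second_countable_topology, real_normed_vector} \<Rightarrow> real"
  assumes F: "\<And>\<zeta>. (\<lambda>x. F x \<zeta>) \<in> borel_measurable M" "\<And>x. continuous_on UNIV (F x)"
    and Z: "Z \<in> borel_measurable M"
  shows "(\<lambda>x. F x (Z x)) \<in> borel_measurable M"
proof -
  \<comment> \<open>For a simple function in place of \<open>Z\<close> only finitely many sections
    of \<open>F\<close> occur; continuity in the second variable passes to the limit.\<close>
  obtain s where s: "\<And>i. simple_function M (s i)" "\<And>x. x \<in> space M \<Longrightarrow> (\<lambda>i. s i x) \<longlonglongrightarrow> Z x"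
    using borel_measurable_implies_sequence_metric[OF Z, of 0] by metis
  show ?thesis
  proof (rule borel_measurable_LIMSEQ_real)
    show "(\<lambda>i. F x (s i x)) \<longlonglongrightarrow> F x (Z x)" if "x \<in> space M" for x
      using F(2)[of x] s(2)[OF that]
      by (metis UNIV_I continuous_on_eq_continuous_at isCont_tendsto_compose open_UNIV)
    show "(\<lambda>x. F x (s i x)) \<in> borel_measurable M" for i
    proof (rule measurable_compose_countable'[where I = "s i ` space M"])
      show "s i \<in> measurable M (count_space (s i ` space M))"
        using s(1)[of i] by (subst measurable_count_space_eq2) (auto simp: simple_function_def)
      show "countable (s i ` space M)"
        using s(1)[of i] by (intro countable_finite) (auto simp: simple_function_def)
    qed (rule F)
  qed
qed

text \<open>The exceptional set is fixed by countably many functions: the sections of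
  \<open>F\<close> at a dense sequence, and the variable part \<open>\<bar>c\<bar>\<close> of the
  Lipschitz constant. On a ball, \<open>Z\<close> has bounded range, which finitely many small balls
  around dense points cover; the Lipschitz bound moves from those points to \<open>Z y\<close>. The
  function c must be blown up too, since the Lipschitz constant is taken at the moving
  point.\<close>

lemma AE_blow_up_caratheodory:
  fixes F :: "'a::euclidean_space \<Rightarrow> 'b::euclidean_space \<Rightarrow> real"
  assumes F: "\<And>\<zeta>. integrable lebesgue (\<lambda>x. F x \<zeta>)" and c: "integrable lebesgue c"
    and lip: "\<And>R. \<exists>M. \<forall>x. \<forall>\<zeta>\<in>cball 0 R. \<forall>\<zeta>'\<in>cball 0 R.
                \<bar>F x \<zeta> - F x \<zeta>'\<bar> \<le> (\<bar>c x\<bar> + M) * norm (\<zeta> - \<zeta>')"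
  obtains \<epsilon> where "\<And>k. 0 < \<epsilon> k" "\<epsilon> \<longlonglongrightarrow> 0"
    "AE x in lebesgue. \<forall>r::nat. \<forall>Z. continuous_on UNIV Z \<longrightarrow>
       (\<forall>k. integrable lebesgue (\<lambda>y. indicator (cball 0 (real r)) y * F (x + \<epsilon> k *\<^sub>R y) (Z y))) \<and>
       (\<lambda>k. LINT y|lebesgue. indicator (cball 0 (real r)) y * F (x + \<epsilon> k *\<^sub>R y) (Z y)) \<longlonglongrightarrow>
         (LINT y|lebesgue. indicator (cball 0 (real r)) y * F x (Z y))"
proof -
  have cont: "continuous_on UNIV (F x)" for x
  proof (rule continuous_at_imp_continuous_on, rule ballI)
    fix \<zeta> :: 'b
    obtain M where M: "\<forall>x. \<forall>\<zeta>'\<in>cball 0 (norm \<zeta> + 1). \<forall>\<zeta>''\<in>cball 0 (norm \<zeta> + 1).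
                \<bar>F x \<zeta>' - F x \<zeta>''\<bar> \<le> (\<bar>c x\<bar> + M) * norm (\<zeta>' - \<zeta>'')"
      using lip by blast
    have "((\<lambda>\<zeta>'. F x \<zeta>' - F x \<zeta>) \<longlongrightarrow> 0) (at \<zeta>)"
    proof (rule Lim_null_comparison)
      have "\<forall>\<^sub>F \<zeta>' in at \<zeta>. dist \<zeta>' \<zeta> < 1"
        by (auto simp: eventually_at intro!: exI[of _ 1])
      then show "\<forall>\<^sub>F \<zeta>' in at \<zeta>. norm (F x \<zeta>' - F x \<zeta>) \<le> (\<bar>c x\<bar> + M) * norm (\<zeta>' - \<zeta>)"
      proof eventually_elim
        case (elim \<zeta>')
        have "norm \<zeta>' \<le> norm \<zeta> + 1"
          using elim norm_triangle_ineq2[of \<zeta>' \<zeta>] by (auto simp: dist_norm)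
        then show ?case using M by auto
      qed
      show "((\<lambda>\<zeta>'. (\<bar>c x\<bar> + M) * norm (\<zeta>' - \<zeta>)) \<longlongrightarrow> 0) (at \<zeta>)"
        by (auto intro!: tendsto_eq_intros)
    qed
    then show "isCont (F x) \<zeta>" by (simp add: isCont_def LIM_zero_cancel)
  qed
  obtain D :: "'b set" where D: "countable D" "\<And>X. open X \<Longrightarrow> X \<noteq> {} \<Longrightarrow> \<exists>d\<in>D. d \<in> X"
    by (rule countable_dense_setE) blast
  have "D \<noteq> {}" using D(2)[of UNIV] by auto
  define q where "q = from_nat_into D"
  \<comment> \<open>Index 0 carries the Lipschitz weight, index \<open>Suc j\<close> the section at
    the j-th dense point.\<close>
  define g where "g i = (case i of 0 \<Rightarrow> (\<lambda>x. \<bar>c x\<bar>) | Suc j \<Rightarrow> (\<lambda>x. F x (q j)))" for i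
  have g_int: "integrable lebesgue (g i)" for i
  proof (cases i)
    case 0
    show ?thesis unfolding g_def 0 nat.case by (rule integrable_abs[OF c])
  next
    case (Suc j)
    show ?thesis unfolding g_def Suc nat.case by (rule F)
  qed
  obtain \<epsilon> where \<epsilon>: "\<And>k. 0 < \<epsilon> k" "\<epsilon> \<longlonglongrightarrow> 0"
    and AE: "AE x in lebesgue. \<forall>i r::nat. (\<lambda>k. LINT y|lebesgue. indicator (cball 0 (real r)) y *
        \<bar>g i (x + \<epsilon> k *\<^sub>R y) - g i x\<bar>) \<longlonglongrightarrow> 0"
    by (rule AE_blow_up[where g = g, OF g_int], rule that)
  show ?thesis
  proof (rule that[of \<epsilon>])
    show "AE x in lebesgue. \<forall>r::nat. \<forall>Z. continuous_on UNIV Z \<longrightarrow>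
       (\<forall>k. integrable lebesgue (\<lambda>y. indicator (cball 0 (real r)) y * F (x + \<epsilon> k *\<^sub>R y) (Z y))) \<and>
       (\<lambda>k. LINT y|lebesgue. indicator (cball 0 (real r)) y * F (x + \<epsilon> k *\<^sub>R y) (Z y)) \<longlonglongrightarrow>
         (LINT y|lebesgue. indicator (cball 0 (real r)) y * F x (Z y))"
      using AE
    proof eventually_elim
      case (elim x)
      show ?case
      proof (intro allI impI)
        fix r :: nat and Z :: "'a \<Rightarrow> 'b"
        assume Z: "continuous_on UNIV Z"
        let ?B = "cball (0::'a) (real r)"
        define V where "V = measure lebesgue ?B"
        have "compact (Z ` ?B)"
          using continuous_on_subset[OF Z subset_UNIV] by (intro compact_continuous_image) simp_all
        then have "bounded (Z ` ?B)" by (rule compact_imp_bounded)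
        then obtain R where "0 < R" "\<forall>z\<in>Z ` ?B. norm z \<le> R"
          unfolding bounded_pos by blast
        then have R: "0 \<le> R" "norm (Z y) \<le> R" if "y \<in> ?B" for y
          using that by auto
        \<comment> \<open>The radius is \<open>R + 1\<close> because a dense point within distance
          \<delta> \<le> 1 of the range of \<open>Z\<close> may lie outside the ball of radius
          \<open>R\<close>.\<close>
        obtain M0 where "\<forall>x. \<forall>\<zeta>\<in>cball 0 (R + 1). \<forall>\<zeta>'\<in>cball 0 (R + 1).
                \<bar>F x \<zeta> - F x \<zeta>'\<bar> \<le> (\<bar>c x\<bar> + M0) * norm (\<zeta> - \<zeta>')"
          using lip[of "R + 1"] ..
        then have M0: "\<bar>F x \<zeta> - F x \<zeta>'\<bar> \<le> (\<bar>c x\<bar> + M0) * norm (\<zeta> - \<zeta>')"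
          if "norm \<zeta> \<le> R + 1" "norm \<zeta>' \<le> R + 1" for x \<zeta> \<zeta>'
          using that by simp
        define M where "M = max M0 0"
        have M: "\<bar>F x \<zeta> - F x \<zeta>'\<bar> \<le> (\<bar>c x\<bar> + M) * norm (\<zeta> - \<zeta>')"
          if "norm \<zeta> \<le> R + 1" "norm \<zeta>' \<le> R + 1" for x \<zeta> \<zeta>'
          by (rule order_trans[OF M0[OF that]]) (auto simp: M_def intro!: mult_right_mono)
        have M_nn: "0 \<le> M" by (simp add: M_def)
        have B: "?B \<in> sets lebesgue" by simp
        have intB: "integrable lebesgue (indicat_real ?B)"
          by (rule lmeasurable_iff_integrable[THEN iffD1]) simp
        have Zm: "Z \<in> borel_measurable lebesgue"
          using Z by (intro measurable_completion) (simp add: borel_measurable_continuous_onI)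
        have Fm: "(\<lambda>y. F (x + s *\<^sub>R y) (Z y)) \<in> borel_measurable lebesgue" for s
        proof (cases "s = 0")
          case True
          show ?thesis
            by (rule borel_measurable_caratheodory[OF _ cont]) (use True in \<open>auto simp: Zm\<close>)
        next
          case False
          show ?thesis
          proof (rule borel_measurable_caratheodory[OF _ cont Zm])
            show "(\<lambda>y. F (x + s *\<^sub>R y) \<zeta>) \<in> borel_measurable lebesgue" for \<zeta>
              using False F[of \<zeta>] by (intro borel_measurable_affine[of "\<lambda>x. F x \<zeta>"]) auto
          qed
        qed
        have gint: "integrable lebesgue (\<lambda>y. g i (x + \<epsilon> k *\<^sub>R y))" for i k
          using \<epsilon>(1)[of k] g_int by (intro integrable_lebesgue_affine) auto
        have F0int: "integrable lebesgue (\<lambda>y. F (x + \<epsilon> k *\<^sub>R y) 0)" for k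
          using \<epsilon>(1)[of k] F by (intro integrable_lebesgue_affine[of _ "\<lambda>x. F x 0"]) auto
        have indint: "integrable lebesgue (\<lambda>y. indicator ?B y * h y)" if "integrable lebesgue h" for h :: "'a \<Rightarrow> real"
          using integrable_mult_indicator[OF B that] by simp
        have g0: "g 0 z = \<bar>c z\<bar>" for z by (simp add: g_def)
        have Fint: "integrable lebesgue (\<lambda>y. indicator ?B y * F (x + \<epsilon> k *\<^sub>R y) (Z y))" for k
        proof (rule Bochner_Integration.integrable_bound)
          show "(\<lambda>y. indicator ?B y * F (x + \<epsilon> k *\<^sub>R y) (Z y)) \<in> borel_measurable lebesgue"
            by (intro borel_measurable_times borel_measurable_indicator B Fm)
          show "integrable lebesgue (\<lambda>y. indicator ?B y * \<bar>F (x + \<epsilon> k *\<^sub>R y) 0\<bar> +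
              (indicator ?B y * g 0 (x + \<epsilon> k *\<^sub>R y) + M * indicator ?B y) * R)"
            using indint[OF integrable_abs[OF F0int[of k]]] indint[OF gint[of 0 k]] intB by simp
          show "AE y in lebesgue. norm (indicator ?B y * F (x + \<epsilon> k *\<^sub>R y) (Z y)) \<le>
             norm (indicator ?B y * \<bar>F (x + \<epsilon> k *\<^sub>R y) 0\<bar> +
              (indicator ?B y * g 0 (x + \<epsilon> k *\<^sub>R y) + M * indicator ?B y) * R)"
          proof (rule AE_I2)
            fix y
            have "\<bar>F (x + \<epsilon> k *\<^sub>R y) (Z y)\<bar> \<le> \<bar>F (x + \<epsilon> k *\<^sub>R y) 0\<bar> + (\<bar>c (x + \<epsilon> k *\<^sub>R y)\<bar> + M) * R"
              if "y \<in> ?B"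
            proof -
              have "\<bar>F (x + \<epsilon> k *\<^sub>R y) (Z y) - F (x + \<epsilon> k *\<^sub>R y) 0\<bar> \<le> (\<bar>c (x + \<epsilon> k *\<^sub>R y)\<bar> + M) * norm (Z y - 0)"
                by (rule M) (use R[OF that] in auto)
              also have "\<dots> \<le> (\<bar>c (x + \<epsilon> k *\<^sub>R y)\<bar> + M) * R"
                by (intro mult_left_mono) (use R(2)[OF that] M_nn in auto)
              finally show ?thesis by linarith
            qed
            then show "norm (indicator ?B y * F (x + \<epsilon> k *\<^sub>R y) (Z y)) \<le>
             norm (indicator ?B y * \<bar>F (x + \<epsilon> k *\<^sub>R y) 0\<bar> +
              (indicator ?B y * g 0 (x + \<epsilon> k *\<^sub>R y) + M * indicator ?B y) * R)"
              by (cases "y \<in> ?B") (force simp: g0)+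
          qed
        qed
        have Fint0: "integrable lebesgue (\<lambda>y. indicator ?B y * F x (Z y))"
        proof (rule Bochner_Integration.integrable_bound)
          show "(\<lambda>y. indicator ?B y * F x (Z y)) \<in> borel_measurable lebesgue"
            using Fm[of 0] by (intro borel_measurable_times borel_measurable_indicator B) simp
          show "integrable lebesgue (\<lambda>y. (\<bar>F x 0\<bar> + (\<bar>c x\<bar> + M) * R) * indicator ?B y)"
            using intB by simp
          show "AE y in lebesgue. norm (indicator ?B y * F x (Z y)) \<le> norm ((\<bar>F x 0\<bar> + (\<bar>c x\<bar> + M) * R) * indicator ?B y)"
          proof (rule AE_I2)
            fix y
            have "\<bar>F x (Z y)\<bar> \<le> \<bar>F x 0\<bar> + (\<bar>c x\<bar> + M) * R" if "y \<in> ?B"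
            proof -
              have "\<bar>F x (Z y) - F x 0\<bar> \<le> (\<bar>c x\<bar> + M) * norm (Z y - 0)"
                by (rule M) (use R[OF that] in auto)
              also have "\<dots> \<le> (\<bar>c x\<bar> + M) * R"
                by (intro mult_left_mono) (use R(2)[OF that] M_nn in auto)
              finally show ?thesis by linarith
            qed
            then show "norm (indicator ?B y * F x (Z y)) \<le> norm ((\<bar>F x 0\<bar> + (\<bar>c x\<bar> + M) * R) * indicator ?B y)"
              by (cases "y \<in> ?B") (force)+
          qed
        qed
        define J where "J i k = (LINT y|lebesgue. indicator ?B y * \<bar>g i (x + \<epsilon> k *\<^sub>R y) - g i x\<bar>)" for i k
        have J: "J i \<longlonglongrightarrow> 0" for i using elim unfolding J_def by blast
        have Jint: "integrable lebesgue (\<lambda>y. indicator ?B y * \<bar>g i (x + \<epsilon> k *\<^sub>R y) - g i x\<bar>)" for i k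
        proof -
          have "integrable lebesgue (\<lambda>y. indicator ?B y * g i (x + \<epsilon> k *\<^sub>R y) - g i x * indicator ?B y)"
            using indint[OF gint[of i k]] intB by simp
          from integrable_abs[OF this] show ?thesis
            by (rule back_subst[where P = "integrable lebesgue"]) (auto simp: indicator_def fun_eq_iff)
        qed
        have "(\<lambda>k. (LINT y|lebesgue. indicator ?B y * F (x + \<epsilon> k *\<^sub>R y) (Z y))
           - (LINT y|lebesgue. indicator ?B y * F x (Z y))) \<longlonglongrightarrow> 0"
        proof (rule LIMSEQ_I)
          fix e :: real assume e: "e > 0"
          \<comment> \<open>Comparing with a dense point costs \<delta> times the Lipschitz constant
            at the moving point and at x. Writing the former through its difference to the latter
            leaves \<delta> (2 |c x| + 2 M), whose integral over the ball is
            \<open>\<delta> * K\<close>. All other errors are among the \<open>J i\<close> and tend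
            to 0.\<close>
          define K where "K = (2 * \<bar>c x\<bar> + 2 * M) * V"
          have K: "K \<ge> 0" using M_nn by (auto simp: K_def V_def)
          define \<delta> where "\<delta> = min 1 (e / (2 * (K + 1)))"
          have \<delta>: "0 < \<delta>" "\<delta> \<le> 1" using e K by (auto simp: \<delta>_def)
          have "\<delta> * K \<le> e / (2 * (K + 1)) * K" using K by (intro mult_right_mono) (auto simp: \<delta>_def)
          also have "\<dots> < e" using e K by (simp add: field_simps add_nonneg_pos)
          finally have \<delta>K: "\<delta> * K < e" .
          have "cball 0 R \<subseteq> (\<Union>n. ball (q n) \<delta>)"
          proof
            fix \<zeta> :: 'b
            obtain d where "d \<in> D" "d \<in> ball \<zeta> \<delta>" using D(2)[of "ball \<zeta> \<delta>"] \<delta> by auto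
            then obtain n where "q n = d" using \<open>countable D\<close> unfolding q_def
              by (metis from_nat_into_surj)
            with \<open>d \<in> ball \<zeta> \<delta>\<close> show "\<zeta> \<in> (\<Union>n. ball (q n) \<delta>)" by (auto simp: dist_commute)
          qed
          then obtain I where I: "finite I" "cball 0 R \<subseteq> (\<Union>n\<in>I. ball (q n) \<delta>)"
            by (rule compactE_image[OF compact_cball, rotated]) auto
          define W where "W k = (\<Sum>i\<in>I. J (Suc i) k) + (\<delta> * J 0 k + \<delta> * K)" for k
          have "W \<longlonglongrightarrow> (\<Sum>i\<in>I. 0) + (\<delta> * 0 + \<delta> * K)"
            unfolding W_def by (intro tendsto_intros J)
          then have "\<forall>\<^sub>F k in sequentially. W k < e"
            using \<delta>K by (intro order_tendstoD) auto
          moreover have "norm ((LINT y|lebesgue. indicator ?B y * F (x + \<epsilon> k *\<^sub>R y) (Z y))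
              - (LINT y|lebesgue. indicator ?B y * F x (Z y)) - 0) \<le> W k" for k
          proof -
            have *: "\<bar>F x' \<zeta> - F x \<zeta>\<bar> \<le> (\<Sum>i\<in>I. \<bar>g (Suc i) x' - g (Suc i) x\<bar>) +
              (\<delta> * \<bar>g 0 x' - g 0 x\<bar> + \<delta> * (2 * \<bar>c x\<bar> + 2 * M))" if \<zeta>: "norm \<zeta> \<le> R" for x' \<zeta>
            proof -
              obtain i where i: "i \<in> I" "dist (q i) \<zeta> < \<delta>" using I(2) \<zeta> by auto
              have "norm (q i) \<le> norm \<zeta> + dist (q i) \<zeta>"
                unfolding dist_norm by (metis norm_triangle_sub)
              then have qi: "norm (q i) \<le> R + 1" using i \<delta> \<zeta> by linarith
              have "\<bar>F z \<zeta> - F z (q i)\<bar> \<le> (\<bar>c z\<bar> + M) * \<delta>" for z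
              proof -
                have "\<bar>F z \<zeta> - F z (q i)\<bar> \<le> (\<bar>c z\<bar> + M) * norm (\<zeta> - q i)"
                  using \<zeta> qi by (intro M) auto
                also have "\<dots> \<le> (\<bar>c z\<bar> + M) * \<delta>"
                  using i(2) M_nn by (intro mult_left_mono) (auto simp: dist_norm norm_minus_commute)
                finally show ?thesis .
              qed
              from this[of x'] this[of x] have "\<bar>F x' \<zeta> - F x \<zeta>\<bar>
                \<le> \<bar>F x' (q i) - F x (q i)\<bar> + ((\<bar>c x'\<bar> + M) * \<delta> + (\<bar>c x\<bar> + M) * \<delta>)" by linarith
              also have "\<bar>F x' (q i) - F x (q i)\<bar> = \<bar>g (Suc i) x' - g (Suc i) x\<bar>"
                by (simp add: g_def)
              also have "\<dots> \<le> (\<Sum>i\<in>I. \<bar>g (Suc i) x' - g (Suc i) x\<bar>)"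
                using I(1) i(1) by (intro member_le_sum) auto
              also have "(\<bar>c x'\<bar> + M) * \<delta> + (\<bar>c x\<bar> + M) * \<delta> \<le> \<delta> * \<bar>g 0 x' - g 0 x\<bar> + \<delta> * (2 * \<bar>c x\<bar> + 2 * M)"
              proof -
                have "\<delta> * \<bar>c x'\<bar> \<le> \<delta> * (\<bar>g 0 x' - g 0 x\<bar> + \<bar>c x\<bar>)"
                  using \<delta> by (intro mult_left_mono) (auto simp: g0)
                then show ?thesis by (simp add: algebra_simps)
              qed
              finally show ?thesis by simp
            qed
            have int: "integrable lebesgue (\<lambda>y. (\<Sum>i\<in>I. indicator ?B y * \<bar>g (Suc i) (x + \<epsilon> k *\<^sub>R y) - g (Suc i) x\<bar>) +
              (\<delta> * (indicator ?B y * \<bar>g 0 (x + \<epsilon> k *\<^sub>R y) - g 0 x\<bar>) + \<delta> * (2 * \<bar>c x\<bar> + 2 * M) * indicator ?B y))"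
              using Jint intB by simp
            have "norm ((LINT y|lebesgue. indicator ?B y * F (x + \<epsilon> k *\<^sub>R y) (Z y))
              - (LINT y|lebesgue. indicator ?B y * F x (Z y)) - 0)
               = norm (LINT y|lebesgue. indicator ?B y * F (x + \<epsilon> k *\<^sub>R y) (Z y) - indicator ?B y * F x (Z y))"
              using Fint[of k] Fint0 by simp
            also have "\<dots> \<le> (LINT y|lebesgue. (\<Sum>i\<in>I. indicator ?B y * \<bar>g (Suc i) (x + \<epsilon> k *\<^sub>R y) - g (Suc i) x\<bar>) +
              (\<delta> * (indicator ?B y * \<bar>g 0 (x + \<epsilon> k *\<^sub>R y) - g 0 x\<bar>) + \<delta> * (2 * \<bar>c x\<bar> + 2 * M) * indicator ?B y))"
            proof (rule order_trans[OF integral_norm_bound], rule integral_mono[OF _ int])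
              show "integrable lebesgue (\<lambda>y. norm (indicator ?B y * F (x + \<epsilon> k *\<^sub>R y) (Z y) - indicator ?B y * F x (Z y)))"
                using Fint[of k] Fint0 by simp
              fix y
              show "norm (indicator ?B y * F (x + \<epsilon> k *\<^sub>R y) (Z y) - indicator ?B y * F x (Z y)) \<le>
               (\<Sum>i\<in>I. indicator ?B y * \<bar>g (Suc i) (x + \<epsilon> k *\<^sub>R y) - g (Suc i) x\<bar>) +
              (\<delta> * (indicator ?B y * \<bar>g 0 (x + \<epsilon> k *\<^sub>R y) - g 0 x\<bar>) + \<delta> * (2 * \<bar>c x\<bar> + 2 * M) * indicator ?B y)"
                using *[OF R(2)[of y], of "x + \<epsilon> k *\<^sub>R y"] by (cases "y \<in> ?B") auto
            qed
            also have "\<dots> = W k"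
              using Jint intB by (simp add: W_def J_def K_def V_def)
            finally show ?thesis .
          qed
          ultimately have "\<forall>\<^sub>F k in sequentially. norm ((LINT y|lebesgue. indicator ?B y * F (x + \<epsilon> k *\<^sub>R y) (Z y))
              - (LINT y|lebesgue. indicator ?B y * F x (Z y)) - 0) < e"
            by (auto elim!: eventually_mono intro: le_less_trans)
          then show "\<exists>no. \<forall>k\<ge>no. norm ((LINT y|lebesgue. indicator ?B y * F (x + \<epsilon> k *\<^sub>R y) (Z y))
              - (LINT y|lebesgue. indicator ?B y * F x (Z y)) - 0) < e"
            by (simp only: eventually_sequentially)
        qed
        then show "(\<forall>k. integrable lebesgue (\<lambda>y. indicator ?B y * F (x + \<epsilon> k *\<^sub>R y) (Z y))) \<and>
          (\<lambda>k. LINT y|lebesgue. indicator ?B y * F (x + \<epsilon> k *\<^sub>R y) (Z y)) \<longlonglongrightarrow>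
         (LINT y|lebesgue. indicator ?B y * F x (Z y))"
          using Fint by (auto intro: LIM_zero_cancel)
      qed
    qed
  qed (use \<epsilon> in auto)
qed

subsection \<open>Smooth cutoff functions\<close>

text \<open>Allows induction on k with an explicit formula for the derivative instead of the chosen
  one in the definition.\<close>

lemma Ck_fun_SucI:
  assumes "\<And>x. (u has_derivative u' x) (at x)" "\<And>v. Ck_fun k (\<lambda>x. u' x v)"
  shows "Ck_fun (Suc k) u"
proof -
  have "frechet_derivative u (at x) = u' x" for x
    using frechet_derivative_at[OF assms(1)] by simp
  then show ?thesis using assms by (auto simp: differentiable_def)
qed

lemma Ck_fun_Suc_has_derivative:
  "Ck_fun (Suc k) u \<Longrightarrow> (u has_derivative frechet_derivative u (at x)) (at x)"
  by (simp add: frechet_derivative_works)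

lemma Ck_fun_Suc_imp: "Ck_fun (Suc k) u \<Longrightarrow> Ck_fun k u"
proof (induction k arbitrary: u)
  case 0
  then show ?case
    by (auto intro!: continuous_at_imp_continuous_on differentiable_imp_continuous_within)
next
  case (Suc k)
  have "\<forall>x. u differentiable (at x)" "\<And>v. Ck_fun (Suc k) (\<lambda>x. frechet_derivative u (at x) v)"
    using Suc.prems unfolding Ck_fun.simps(2)[of "Suc k"] by blast+
  then show ?case
    unfolding Ck_fun.simps(2)[of k u] using Suc.IH by blast
qed

lemma Ck_fun_const [simp]: "Ck_fun k (\<lambda>x. c)"
proof (induction k arbitrary: c)
  case (Suc k)
  show ?case
    by (rule Ck_fun_SucI[where u' = "\<lambda>x v. 0", OF has_derivative_const Suc])
qed simp

lemma Ck_fun_bounded_linear: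
  assumes "bounded_linear L" "Ck_fun k u"
  shows "Ck_fun k (\<lambda>x. L (u x))"
  using assms(2)
proof (induction k arbitrary: u)
  case 0
  then show ?case by (auto intro: bounded_linear.continuous_on[OF assms(1)])
next
  case (Suc k)
  show ?case
    by (rule Ck_fun_SucI[where u' = "\<lambda>x v. L (frechet_derivative u (at x) v)"],
        rule bounded_linear.has_derivative[OF assms(1) Ck_fun_Suc_has_derivative[OF Suc.prems]])
       (use Suc in auto)
qed

lemma Ck_fun_add:
  "Ck_fun k u \<Longrightarrow> Ck_fun k w \<Longrightarrow> Ck_fun k (\<lambda>x. u x + w x)"
proof (induction k arbitrary: u w)
  case 0
  then show ?case by (auto intro: continuous_on_add)
next
  case (Suc k)
  show ?case
    by (rule Ck_fun_SucI[where u' = "\<lambda>x v. frechet_derivative u (at x) v + frechet_derivative w (at x) v"],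
        rule has_derivative_add[OF Suc.prems[THEN Ck_fun_Suc_has_derivative]])
       (use Suc in auto)
qed

text \<open>One product rule for real products, scalar multiples and inner products. Each term of
  the derivative pairs a derivative with an undifferentiated factor, hence the descent from
  \<open>Suc k\<close> to k for the latter.\<close>

lemma Ck_fun_bounded_bilinear:
  assumes "bounded_bilinear B"
  shows "Ck_fun k u \<Longrightarrow> Ck_fun k w \<Longrightarrow> Ck_fun k (\<lambda>x. B (u x) (w x))"
proof (induction k arbitrary: u w)
  case 0
  then show ?case by (auto intro: bounded_bilinear.continuous_on[OF assms])
next
  case (Suc k)
  show ?case
  proof (rule Ck_fun_SucI)
    show "((\<lambda>x. B (u x) (w x)) has_derivative
       (\<lambda>v. B (u x) (frechet_derivative w (at x) v) + B (frechet_derivative u (at x) v) (w x))) (at x)" for x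
      by (intro bounded_bilinear.FDERIV[OF assms] Ck_fun_Suc_has_derivative[OF Suc.prems(1)]
          Ck_fun_Suc_has_derivative[OF Suc.prems(2)])
    show "Ck_fun k (\<lambda>x. B (u x) (frechet_derivative w (at x) v) + B (frechet_derivative u (at x) v) (w x))" for v
      using Suc.prems Suc.prems[THEN Ck_fun_Suc_imp]
      by (intro Ck_fun_add Suc.IH) auto
  qed
qed

lemma Ck_fun_affine:
  fixes u :: "'a::real_normed_vector \<Rightarrow> 'b::real_normed_vector"
  shows "Ck_fun k u \<Longrightarrow> Ck_fun k (\<lambda>x. u (b + c *\<^sub>R x))"
proof (induction k arbitrary: u)
  case 0
  then have "continuous_on UNIV (u \<circ> (\<lambda>x. b + c *\<^sub>R x))"
    by (intro continuous_on_compose continuous_intros) (auto intro: continuous_on_subset)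
  then show ?case by (simp add: o_def)
next
  case (Suc k)
  show ?case
  proof (rule Ck_fun_SucI)
    show "((\<lambda>x. u (b + c *\<^sub>R x)) has_derivative
       (\<lambda>v. frechet_derivative u (at (b + c *\<^sub>R x)) (c *\<^sub>R v))) (at x)" for x
      by (rule has_derivative_compose[OF _ Ck_fun_Suc_has_derivative[OF Suc.prems]])
         (auto intro!: derivative_eq_intros)
    show "Ck_fun k (\<lambda>x. frechet_derivative u (at (b + c *\<^sub>R x)) (c *\<^sub>R v))" for v
      using Suc.prems by (intro Suc.IH[of "\<lambda>x. frechet_derivative u (at x) (c *\<^sub>R v)"]) auto
  qed
qed

lemma Ck_fun_ident: "Ck_fun k (\<lambda>x. x)"
proof (cases k)
  case (Suc j)
  show ?thesis unfolding Suc
    by (rule Ck_fun_SucI[where u' = "\<lambda>x v. v", OF has_derivative_ident Ck_fun_const])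
qed simp

lemma Ck_fun_compose_real:
  fixes s :: "real \<Rightarrow> real"
  shows "Ck_fun k s \<Longrightarrow> Ck_fun k h \<Longrightarrow> Ck_fun k (\<lambda>x. s (h x))"
proof (induction k arbitrary: s h)
  case 0
  then have "continuous_on UNIV (s \<circ> h)"
    by (intro continuous_on_compose) (auto intro: continuous_on_subset)
  then show ?case by (simp add: o_def)
next
  case (Suc k)
  \<comment> \<open>The derivative of a real function is multiplication by a number, so the chain
    rule produces a product to which the bilinear rule applies.\<close>
  define s' where "s' t = frechet_derivative s (at t) 1" for t
  have s': "frechet_derivative s (at t) r = r * s' t" for t r
    using linear_cmul[OF linear_frechet_derivative, of s "at t" r 1] Suc.prems by (simp add: s'_def)
  show ?case
  proof (rule Ck_fun_SucI)
    show "((\<lambda>x. s (h x)) has_derivative (\<lambda>v. frechet_derivative h (at x) v * s' (h x))) (at x)" for x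
      using has_derivative_compose[OF Ck_fun_Suc_has_derivative[OF Suc.prems(2)]
          Ck_fun_Suc_has_derivative[OF Suc.prems(1)]] by (simp add: s')
    show "Ck_fun k (\<lambda>x. frechet_derivative h (at x) v * s' (h x))" for v
    proof (rule Ck_fun_bounded_bilinear[OF bounded_bilinear_mult])
      show "Ck_fun k (\<lambda>x. frechet_derivative h (at x) v)" using Suc.prems by simp
      have "Ck_fun k s'" unfolding s'_def using Suc.prems by simp
      then show "Ck_fun k (\<lambda>x. s' (h x))" by (rule Suc.IH) (rule Ck_fun_Suc_imp[OF Suc.prems(2)])
    qed
  qed
qed

text \<open>The classical flat function exp(-1/x), together with its multiples by powers of 1/x: up
  to linear combinations this family is closed under differentiation, so that smoothness follows by
  one induction for all m.\<close>

definition flat_exp :: "nat \<Rightarrow> real \<Rightarrow> real" where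
  "flat_exp m x = (if 0 < x then inverse x ^ m / exp (inverse x) else 0)"

lemma flat_exp_tendsto_0: "(flat_exp m \<longlongrightarrow> 0) (at 0)"
proof (rule filterlim_split_at)
  have "((\<lambda>x::real. inverse x ^ m / exp (inverse x)) \<longlongrightarrow> 0) (at_right 0)"
    by (rule filterlim_compose[OF tendsto_power_div_exp_0 filterlim_inverse_at_top_right])
  then show "(flat_exp m \<longlongrightarrow> 0) (at_right 0)"
    by (rule Lim_transform_eventually) (auto simp: eventually_at_filter flat_exp_def)
  show "(flat_exp m \<longlongrightarrow> 0) (at_left 0)"
    by (rule Lim_transform_eventually[OF tendsto_const]) (auto simp: eventually_at_filter flat_exp_def)
qed

lemma flat_exp_has_derivative:
  "(flat_exp m has_real_derivative flat_exp (m + 2) x - real m * flat_exp (m + 1) x) (at x)"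
proof -
  consider "x > 0" | "x < 0" | "x = 0" by linarith
  then show ?thesis
  proof cases
    case 1
    define y where "y = inverse x"
    have "((\<lambda>y. y ^ m * exp (- y)) has_real_derivative real m * y ^ (m - 1) * exp (- y) - y ^ m * exp (- y)) (at (inverse x))"
      unfolding y_def by (auto intro!: derivative_eq_intros)
    moreover have "(inverse has_real_derivative - (y ^ 2)) (at x)"
      using DERIV_inverse[of x UNIV] 1 by (simp add: y_def numeral_2_eq_2)
    ultimately have "((\<lambda>x. inverse x ^ m * exp (- inverse x)) has_real_derivative
        (real m * y ^ (m - 1) * exp (- y) - y ^ m * exp (- y)) * - (y ^ 2)) (at x)"
      by (rule DERIV_chain2)
    also have "(real m * y ^ (m - 1) * exp (- y) - y ^ m * exp (- y)) * - (y ^ 2)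
      = flat_exp (m + 2) x - real m * flat_exp (m + 1) x"
      using 1 by (cases m) (simp_all add: flat_exp_def y_def[symmetric] exp_minus divide_inverse algebra_simps power2_eq_square)
    finally have d: "((\<lambda>x. inverse x ^ m * exp (- inverse x)) has_real_derivative flat_exp (m + 2) x - real m * flat_exp (m + 1) x) (at x)" .
    have ev: "\<forall>\<^sub>F y in nhds x. flat_exp m y = inverse y ^ m * exp (- inverse y)"
      using eventually_nhds_in_open[of "{0<..}" x] 1
      by (auto elim!: eventually_mono simp: flat_exp_def exp_minus divide_inverse)
    show ?thesis
      by (rule DERIV_cong_ev[OF refl ev refl, THEN iffD2, OF d])
  next
    case 2
    have "\<forall>\<^sub>F y in nhds x. flat_exp m y = 0"
      using eventually_nhds_in_open[of "{..<0}" x] 2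
      by (auto elim!: eventually_mono simp: flat_exp_def)
    then have "(flat_exp m has_real_derivative 0) (at x) \<longleftrightarrow> ((\<lambda>_. 0) has_real_derivative 0) (at x)"
      by (intro DERIV_cong_ev) auto
    then show ?thesis using 2 by (simp add: flat_exp_def)
  next
    case 3
    \<comment> \<open>At the origin the difference quotient is again a member of the family, and all
      members tend to 0 there.\<close>
    have "(\<lambda>h. (flat_exp m (0 + h) - flat_exp m 0) / h) = flat_exp (Suc m)"
      by (simp add: fun_eq_iff flat_exp_def divide_inverse mult_ac)
    then have "(flat_exp m has_real_derivative 0) (at 0)"
      using flat_exp_tendsto_0[of "Suc m"] by (simp add: DERIV_def)
    then show ?thesis using 3 by (simp add: flat_exp_def)
  qed
qed

lemma Ck_fun_flat_exp: "Ck_fun k (flat_exp m)"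
proof (induction k arbitrary: m)
  case 0
  show ?case
    unfolding Ck_fun.simps(1)
    by (rule DERIV_continuous_on[OF has_field_derivative_at_within[OF flat_exp_has_derivative]])
next
  case (Suc k)
  show ?case
  proof (rule Ck_fun_SucI)
    show "(flat_exp m has_derivative (\<lambda>v. (flat_exp (m + 2) x + (- real m) * flat_exp (m + 1) x) * v)) (at x)" for x
      using flat_exp_has_derivative[of m x] by (simp add: has_field_derivative_def)
    show "Ck_fun k (\<lambda>x. (flat_exp (m + 2) x + (- real m) * flat_exp (m + 1) x) * v)" for v
      by (intro Ck_fun_bounded_linear[OF bounded_linear_mult_left] Ck_fun_add Suc
          Ck_fun_bounded_linear[OF bounded_linear_mult_right])
  qed
qed

text \<open>Write g for \<open>flat_exp 0\<close>. The cutoff is g(c - g(|x - x0|^2 - r^2)) / g(c):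
  the inner g vanishes up to distance r, which gives the value 1, and it reaches c at distance 2 r,
  after which the outer g vanishes.\<close>

lemma smooth_cutoff:
  fixes x0 :: "'a::euclidean_space"
  assumes "r > 0"
  obtains \<zeta> :: "'a \<Rightarrow> real" where "\<And>k. Ck_fun k \<zeta>" "\<And>x. 0 \<le> \<zeta> x" "\<And>x. dist x0 x \<le> r \<Longrightarrow> \<zeta> x = 1"
    "\<And>x. 2 * r \<le> dist x0 x \<Longrightarrow> \<zeta> x = 0"
proof -
  have pos: "flat_exp 0 t > 0 \<longleftrightarrow> t > 0" and zero: "t \<le> 0 \<Longrightarrow> flat_exp 0 t = 0" for t by (auto simp: flat_exp_def)
  have mono: "flat_exp 0 s \<le> flat_exp 0 t" if "0 < s" "s \<le> t" for s t
    using that by (auto simp: flat_exp_def divide_simps)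
  \<comment> \<open>The value of the inner function at distance 2 r, as (2 r)^2 - r^2 = 3
    r^2.\<close>
  define c where "c = flat_exp 0 (3 * r\<^sup>2)"
  have c: "c > 0" using assms by (simp add: c_def pos)
  \<comment> \<open>Scalings by 1 and -1 are spelled out so that the closure rules for
    \<open>Ck_fun\<close> match literally; the readable form follows.\<close>
  define \<zeta> where "\<zeta> x = flat_exp 0 (c + (-1) *\<^sub>R flat_exp 0 (- (r\<^sup>2) + 1 *\<^sub>R ((- x0 + 1 *\<^sub>R x) \<bullet> (- x0 + 1 *\<^sub>R x)))) * inverse (flat_exp 0 c)" for x
  have \<zeta>: "\<zeta> x = flat_exp 0 (c - flat_exp 0 ((dist x0 x)\<^sup>2 - r\<^sup>2)) / flat_exp 0 c" for x
    by (simp add: \<zeta>_def dist_norm norm_minus_commute[of x0] divide_inverse flip: power2_norm_eq_inner)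
  show ?thesis
  proof (rule that[of \<zeta>])
    show "Ck_fun k \<zeta>" for k
    proof -
      have aff: "Ck_fun k (\<lambda>x. - x0 + 1 *\<^sub>R x)"
        by (rule Ck_fun_affine[OF Ck_fun_ident])
      have scale: "Ck_fun k (\<lambda>x. b + s *\<^sub>R u x)" if "Ck_fun k u" for b s :: real and u :: "'a \<Rightarrow> real"
        by (rule Ck_fun_add[OF Ck_fun_const Ck_fun_bounded_linear[OF bounded_linear_scaleR_right that]])
      have flat: "Ck_fun k (\<lambda>x. flat_exp 0 (u x))" if "Ck_fun k u" for u :: "'a \<Rightarrow> real"
        by (rule Ck_fun_compose_real[OF Ck_fun_flat_exp that])
      show ?thesis
        unfolding \<zeta>_def
        by (rule Ck_fun_bounded_linear[OF bounded_linear_mult_left flat[OF scale[OF flat[OF scale[OF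
              Ck_fun_bounded_bilinear[OF bounded_bilinear_inner aff aff]]]]]])
    qed
    show "0 \<le> \<zeta> x" for x by (simp add: \<zeta> flat_exp_def)
    show "\<zeta> x = 1" if "dist x0 x \<le> r" for x
    proof -
      have "(dist x0 x)\<^sup>2 \<le> r\<^sup>2" using that by (intro power_mono) auto
      then have "flat_exp 0 ((dist x0 x)\<^sup>2 - r\<^sup>2) = 0" by (intro zero) simp
      then show ?thesis using c pos[of c] by (simp add: \<zeta>)
    qed
    show "\<zeta> x = 0" if "2 * r \<le> dist x0 x" for x
    proof -
      have "(2 * r)\<^sup>2 \<le> (dist x0 x)\<^sup>2" using that assms by (intro power_mono) auto
      then have "c \<le> flat_exp 0 ((dist x0 x)\<^sup>2 - r\<^sup>2)"
        unfolding c_def using assms by (intro mono) auto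
      then show ?thesis by (simp add: \<zeta> zero)
    qed
  qed
qed

subsection \<open>Test functions and their weak Jacobians\<close>

lemma integrable_continuous_compact_support:
  fixes f :: "'a::euclidean_space \<Rightarrow> 'b::euclidean_space"
  assumes f: "continuous_on UNIV f" and K: "compact K" "\<And>x. x \<notin> K \<Longrightarrow> f x = 0"
  shows "integrable lebesgue f"
proof -
  have "integrable lborel (\<lambda>x. indicator K x *\<^sub>R f x)"
    by (rule borel_integrable_compact[OF K(1) continuous_on_subset[OF f subset_UNIV]])
  also have "(\<lambda>x. indicator K x *\<^sub>R f x) = f"
    using K(2) by (auto simp: fun_eq_iff indicator_def)
  finally show ?thesis
    using borel_measurable_continuous_onI[OF f] by (simp add: integrable_completion)
qed

lemma continuous_compact_support_bounded:
  fixes f :: "'a::metric_space \<Rightarrow> 'b::real_normed_vector"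
  assumes f: "continuous_on UNIV f" and K: "compact K" "\<And>x. x \<notin> K \<Longrightarrow> f x = 0"
  obtains C where "0 < C" "\<And>x. norm (f x) \<le> C"
proof -
  have "compact (f ` K)"
    by (rule compact_continuous_image[OF continuous_on_subset[OF f subset_UNIV] K(1)])
  then have "bounded (f ` K)" by (rule compact_imp_bounded)
  then obtain C where C: "0 < C" "\<forall>y\<in>f ` K. norm y \<le> C" unfolding bounded_pos by blast
  have "norm (f x) \<le> C" for x using C K(2)[of x] by (cases "x \<in> K") auto
  then show ?thesis using that C(1) by blast
qed

lemma integral_lebesgue_on_eq:
  fixes f :: "'a::euclidean_space \<Rightarrow> 'b::{banach, second_countable_topology}"
  assumes "S \<in> sets lebesgue" "\<And>x. x \<notin> S \<Longrightarrow> f x = 0"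
  shows "(LINT x|lebesgue_on S. f x) = (LINT x|lebesgue. f x)"
proof -
  have "(LINT x|lebesgue_on S. f x) = (LINT x|lebesgue. indicator S x *\<^sub>R f x)"
    by (rule integral_restrict_space) (use assms in simp)
  also have "(\<lambda>x. indicator S x *\<^sub>R f x) = f"
    using assms(2) by (auto simp: fun_eq_iff indicator_def)
  finally show ?thesis .
qed

lemma integrable_lebesgue_onI:
  fixes f :: "'a::euclidean_space \<Rightarrow> 'b::{banach, second_countable_topology}"
  assumes "S \<in> sets lebesgue" "integrable lebesgue f"
  shows "integrable (lebesgue_on S) f"
proof -
  have "integrable lebesgue (\<lambda>x. indicator S x *\<^sub>R f x)"
    by (rule integrable_mult_indicator[OF assms])
  then show ?thesis using assms(1) by (subst integrable_restrict_space) auto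
qed

text \<open>Translation invariance makes every difference quotient integrate to 0. The quotients are
  bounded by the mean value theorem and supported in a common compact set, so dominated convergence
  carries this over to the derivative.\<close>

lemma integral_directional_derivative_eq_0:
  fixes h :: "'a::euclidean_space \<Rightarrow> real"
  assumes h: "\<And>x. h differentiable (at x)"
    and cont: "continuous_on UNIV (\<lambda>x. frechet_derivative h (at x) v)"
    and K: "compact K" "\<And>x. x \<notin> K \<Longrightarrow> h x = 0"
  shows "(LINT x|lebesgue. frechet_derivative h (at x) v) = 0"
proof -
  define h' where "h' x = frechet_derivative h (at x) v" for x
  have der: "(h has_derivative frechet_derivative h (at x)) (at x)" for x
    using h by (simp add: frechet_derivative_works)
  have hcont: "continuous_on UNIV h"
    using h by (auto intro!: continuous_at_imp_continuous_on differentiable_imp_continuous_within)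
  have hint: "integrable lebesgue h"
    by (rule integrable_continuous_compact_support[OF hcont K])
  have h'0: "h' x = 0" if "x \<notin> K" for x
  proof -
    have "\<forall>\<^sub>F y in nhds x. y \<in> - K"
      using K(1) that by (intro eventually_nhds_in_open) (auto simp: compact_imp_closed)
    then have ev: "\<forall>\<^sub>F y in nhds x. h y = 0" by eventually_elim (use K in auto)
    have "(h has_derivative (\<lambda>_. 0)) (at x)"
      by (rule has_derivative_transform_eventually[of "\<lambda>_. 0"])
         (use ev K(2)[OF that] in \<open>auto simp: eventually_at_filter elim!: eventually_mono\<close>)
    then show ?thesis unfolding h'_def using frechet_derivative_at by metis
  qed
  obtain C where C: "0 < C" "\<And>x. norm (h' x) \<le> C"
    by (rule continuous_compact_support_bounded[OF cont[folded h'_def] K(1) h'0], assumption, rule that)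
  have line: "((\<lambda>t. h (x + t *\<^sub>R v)) has_real_derivative h' (x + t *\<^sub>R v)) (at t)" for x t
  proof -
    have "((\<lambda>t. h (x + t *\<^sub>R v)) has_derivative (\<lambda>r. frechet_derivative h (at (x + t *\<^sub>R v)) (r *\<^sub>R v))) (at t)"
      by (rule has_derivative_compose[OF _ der]) (auto intro!: derivative_eq_intros)
    moreover have "frechet_derivative h (at (x + t *\<^sub>R v)) (r *\<^sub>R v) = h' (x + t *\<^sub>R v) * r" for r
      using linear_cmul[OF linear_frechet_derivative[OF h]] by (simp add: h'_def)
    ultimately show ?thesis by (simp add: has_field_derivative_def)
  qed
  have bd: "\<bar>h (x + t *\<^sub>R v) - h x\<bar> \<le> C * t" if t: "0 < t" for x t
  proof -
    obtain z where "h (x + t *\<^sub>R v) - h (x + 0 *\<^sub>R v) = (t - 0) * h' (x + z *\<^sub>R v)"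
      using MVT2[OF t, of "\<lambda>t. h (x + t *\<^sub>R v)" "\<lambda>t. h' (x + t *\<^sub>R v)"] line by blast
    then show ?thesis using C(2)[of "x + z *\<^sub>R v"] t
      by (simp add: abs_mult mult.commute mult_right_mono)
  qed
  define s where "s n = 1 / (real n + 1)" for n
  have s: "0 < s n" "s n \<le> 1" for n by (auto simp: s_def)
  have s0: "s \<longlonglongrightarrow> 0"
    unfolding s_def using LIMSEQ_inverse_real_of_nat by (simp add: inverse_eq_divide add.commute)
  \<comment> \<open>The set swept by \<open>K\<close> under backward translations of parameter at
    most 1; off it, both terms of each difference quotient vanish.\<close>
  define K' where "K' = (\<lambda>(x, t). x - t *\<^sub>R v) ` (K \<times> {0..1::real})"
  have K': "compact K'"
    unfolding K'_def case_prod_beta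
    by (intro compact_continuous_image compact_Times K continuous_intros compact_Icc)
  have off: "h (x + s n *\<^sub>R v) - h x = 0" if "x \<notin> K'" for x n
  proof -
    have "x \<notin> K" using that unfolding K'_def by (force intro: image_eqI[of _ _ "(x, 0)"])
    moreover have "x + s n *\<^sub>R v \<notin> K"
    proof
      assume "x + s n *\<^sub>R v \<in> K"
      then have "(\<lambda>(x, t). x - t *\<^sub>R v) (x + s n *\<^sub>R v, s n) \<in> K'"
        unfolding K'_def using s[of n] by (intro imageI) auto
      then show False using that by simp
    qed
    ultimately show ?thesis using K(2) by simp
  qed
  have lim: "(\<lambda>n. LINT x|lebesgue. (h (x + s n *\<^sub>R v) - h x) / s n) \<longlonglongrightarrow> (LINT x|lebesgue. h' x)"
  proof (rule integral_dominated_convergence)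
    show "h' \<in> borel_measurable lebesgue"
      using integrable_continuous_compact_support[OF cont[folded h'_def] K(1) h'0] by simp
    show "integrable lebesgue (\<lambda>x. C * indicator K' x)"
      using K' by (intro integrable_mult_right) (auto simp: lmeasurable_compact simp flip: lmeasurable_iff_integrable)
    show "(\<lambda>x. (h (x + s n *\<^sub>R v) - h x) / s n) \<in> borel_measurable lebesgue" for n
      using integrable_lebesgue_affine[of 1 h "s n *\<^sub>R v"] hint by (auto simp: add.commute)
    show "AE x in lebesgue. (\<lambda>n. (h (x + s n *\<^sub>R v) - h x) / s n) \<longlonglongrightarrow> h' x"
    proof (rule AE_I2)
      fix x
      have "((\<lambda>t. (h (x + t *\<^sub>R v) - h x) / t) \<longlongrightarrow> h' x) (at 0)"
        using line[of x 0] by (simp add: DERIV_def)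
      moreover have "filterlim s (at 0) sequentially"
        using s0 s by (auto simp: filterlim_at less_imp_neq[symmetric] intro!: always_eventually)
      ultimately show "(\<lambda>n. (h (x + s n *\<^sub>R v) - h x) / s n) \<longlonglongrightarrow> h' x"
        by (rule filterlim_compose)
    qed
    show "AE x in lebesgue. norm ((h (x + s n *\<^sub>R v) - h x) / s n) \<le> C * indicator K' x" for n
    proof (rule AE_I2)
      fix x
      show "norm ((h (x + s n *\<^sub>R v) - h x) / s n) \<le> C * indicator K' x"
      proof (cases "x \<in> K'")
        case True
        then show ?thesis using bd[OF s(1)[of n], of x] s(1)[of n] by (simp add: divide_le_eq)
      next
        case False
        then show ?thesis using off[OF False, of n] by simp
      qed
    qed
  qed
  have zero: "(LINT x|lebesgue. (h (x + s n *\<^sub>R v) - h x) / s n) = 0" for n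
  proof -
    have "integrable lebesgue (\<lambda>x. h (x + s n *\<^sub>R v))"
      using integrable_lebesgue_affine[of 1 h "s n *\<^sub>R v"] hint by (simp add: add.commute)
    moreover have "(LINT x|lebesgue. h (x + s n *\<^sub>R v)) = (LINT x|lebesgue. h x)"
      using integral_lebesgue_affine[of 1 h "s n *\<^sub>R v"] hint by (simp add: add.commute)
    ultimately show ?thesis using hint by simp
  qed
  show ?thesis using lim unfolding zero h'_def by (simp add: LIMSEQ_const_iff)
qed

text \<open>Completeness of Lebesgue measure, after extension by zero to the whole space.\<close>

lemma AE_lebesgue_measurable_cong:
  fixes f g :: "'a::euclidean_space \<Rightarrow> 'b::euclidean_space"
  assumes "f \<in> borel_measurable (lebesgue_on S)" "AE x in lebesgue_on S. f x = g x" "S \<in> sets lebesgue"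
  shows "g \<in> borel_measurable (lebesgue_on S)"
proof -
  have "(\<lambda>x. if x \<in> S then f x else 0) \<in> borel_measurable lebesgue"
    using assms(1,3) borel_measurable_if by blast
  moreover have "AE x in lebesgue. (if x \<in> S then f x else 0) = (if x \<in> S then g x else 0)"
    using assms(2,3) by (subst (asm) AE_restrict_space_iff) (auto elim!: eventually_mono)
  ultimately have "(\<lambda>x. if x \<in> S then g x else 0) \<in> borel_measurable lebesgue"
    by (rule borel_measurable_AE)
  then show ?thesis using assms(3) borel_measurable_if by blast
qed

lemma C0_infI:
  fixes \<phi> :: "'a::euclidean_space \<Rightarrow> 'b::real_normed_vector"
  assumes "\<And>k. Ck_fun k \<phi>" "\<And>x. x \<notin> K \<Longrightarrow> \<phi> x = 0" "compact K" "K \<subseteq> G"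
  shows "\<phi> \<in> C0_inf G"
proof -
  have sub: "closure {x. \<phi> x \<noteq> 0} \<subseteq> K"
    using assms(2) compact_imp_closed[OF assms(3)] by (intro closure_minimal) auto
  then have "compact (closure {x. \<phi> x \<noteq> 0})"
    using compact_imp_bounded[OF assms(3)] closed_closure bounded_subset by (simp only: compact_eq_bounded_closed) blast
  then show ?thesis using assms sub by (auto simp: C0_inf_def)
qed

lemma C0_infE:
  assumes "\<phi> \<in> C0_inf G"
  obtains K where "compact K" "K \<subseteq> G" "\<And>x. x \<notin> K \<Longrightarrow> \<phi> x = 0" "\<And>k. Ck_fun k \<phi>"
proof (rule that)
  show "compact (closure {x. \<phi> x \<noteq> 0})" "closure {x. \<phi> x \<noteq> 0} \<subseteq> G" "Ck_fun k \<phi>" for k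
    using assms by (auto simp: C0_inf_def)
  show "\<phi> x = 0" if "x \<notin> closure {x. \<phi> x \<noteq> 0}" for x
    using that closure_subset[of "{x. \<phi> x \<noteq> 0}"] by auto
qed

lemma Jac_eqI:
  assumes "(\<phi> has_derivative (\<lambda>h. A *v h)) (at x)"
  shows "Jac \<phi> x = A"
  using frechet_derivative_at[OF assms, symmetric] by (simp add: jacobian_def)

lemma Jac_has_derivative:
  fixes \<phi> :: "real^'n \<Rightarrow> real^'m"
  assumes "\<And>k. Ck_fun k \<phi>"
  shows "(\<phi> has_derivative (\<lambda>h. Jac \<phi> x *v h)) (at x)"
  using assms[of 1] jacobian_works[of \<phi> "at x"] by simp

lemma continuous_on_Jac:
  fixes \<phi> :: "real^'n \<Rightarrow> real^'m"
  assumes "\<And>k. Ck_fun k \<phi>"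
  shows "continuous_on UNIV (Jac \<phi>)"
proof -
  have "continuous_on UNIV (\<lambda>x. frechet_derivative \<phi> (at x) v)" for v
    using assms[of "Suc 0"] by simp
  then have "continuous_on UNIV (\<lambda>x. \<chi> i j. frechet_derivative \<phi> (at x) (axis j 1) $ i)"
    by (intro continuous_on_vec_lambda continuous_on_component)
  then show ?thesis by (simp add: jacobian_def matrix_def)
qed

lemma Jac_eq_0_outside:
  fixes \<phi> :: "real^'n \<Rightarrow> real^'m"
  assumes "compact K" "\<And>x. x \<notin> K \<Longrightarrow> \<phi> x = 0" "x \<notin> K"
  shows "Jac \<phi> x = 0"
proof (rule Jac_eqI)
  have "\<forall>\<^sub>F y in nhds x. y \<in> - K"
    using assms(1,3) by (intro eventually_nhds_in_open) (auto simp: compact_imp_closed)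
  then have ev: "\<forall>\<^sub>F y in nhds x. \<phi> y = 0" by eventually_elim (use assms in auto)
  have "(\<phi> has_derivative (\<lambda>_. 0)) (at x)"
    by (rule has_derivative_transform_eventually[of "\<lambda>_. 0"])
       (use ev assms in \<open>auto simp: eventually_at_filter elim!: eventually_mono\<close>)
  then show "(\<phi> has_derivative (\<lambda>h. 0 *v h)) (at x)" by simp
qed

lemma integrable_mult_bounded_support:
  fixes g \<psi> :: "'a::euclidean_space \<Rightarrow> real"
  assumes g: "integrable (lebesgue_on K) g" and K: "compact K" "\<And>x. x \<notin> K \<Longrightarrow> \<psi> x = 0"
    and \<psi>: "continuous_on UNIV \<psi>"
  shows "integrable lebesgue (\<lambda>x. g x * \<psi> x)"
proof -
  obtain C where C: "0 < C" "\<And>x. norm (\<psi> x) \<le> C"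
    by (rule continuous_compact_support_bounded[OF \<psi> K], assumption, rule that)
  have gK: "integrable lebesgue (\<lambda>x. indicator K x *\<^sub>R g x)"
    using g K(1) by (subst (asm) integrable_restrict_space) (auto simp: lmeasurable_compact fmeasurableD)
  have "integrable lebesgue (\<lambda>x. (indicator K x *\<^sub>R g x) * \<psi> x)"
  proof (rule Bochner_Integration.integrable_bound)
    show "integrable lebesgue (\<lambda>x. (indicator K x *\<^sub>R g x) * C)" using gK by simp
    show "(\<lambda>x. (indicator K x *\<^sub>R g x) * \<psi> x) \<in> borel_measurable lebesgue"
      using borel_measurable_integrable[OF gK]
        borel_measurable_integrable[OF integrable_continuous_compact_support[OF \<psi> K]]
      by (rule borel_measurable_times)
    show "AE x in lebesgue. norm ((indicator K x *\<^sub>R g x) * \<psi> x) \<le> norm ((indicator K x *\<^sub>R g x) * C)"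
      using C by (intro AE_I2) (auto simp: abs_mult intro!: mult_left_mono)
  qed
  also have "(\<lambda>x. (indicator K x *\<^sub>R g x) * \<psi> x) = (\<lambda>x. g x * \<psi> x)"
    using K(2) by (auto simp: indicator_def fun_eq_iff)
  finally show ?thesis .
qed

text \<open>Integration by parts: the product of a component of \<phi> with \<psi> has compact
  support, so its directional derivative integrates to 0, and the Leibniz rule splits that
  integral.\<close>

lemma weak_jacobian_Jac:
  fixes \<phi> :: "real^'n \<Rightarrow> real^'m"
  assumes \<Omega>: "open \<Omega>" and \<phi>: "\<phi> \<in> C0_inf \<Omega>"
  shows "weak_jacobian \<Omega> \<phi> (Jac \<phi>)"
proof -
  obtain K where K: "compact K" "K \<subseteq> \<Omega>" "\<And>x. x \<notin> K \<Longrightarrow> \<phi> x = 0" and sm: "\<And>k. Ck_fun k \<phi>"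
    by (rule C0_infE[OF \<phi>], rule that)
  have c\<phi>: "continuous_on UNIV \<phi>" using sm[of 0] by simp
  have i\<phi>: "integrable lebesgue \<phi>" by (rule integrable_continuous_compact_support[OF c\<phi> K(1,3)])
  have iJ: "integrable lebesgue (Jac \<phi>)"
    by (rule integrable_continuous_compact_support[OF continuous_on_Jac[OF sm] K(1) Jac_eq_0_outside[OF K(1,3)]])
  have parts: "(LINT x|lebesgue_on \<Omega>. \<phi> x $ i * frechet_derivative \<psi> (at x) (axis j 1)) =
        - (LINT x|lebesgue_on \<Omega>. Jac \<phi> x $ i $ j * (\<psi> x :: real))" if \<psi>: "\<psi> \<in> C0_inf \<Omega>" for \<psi> i j
  proof -
    have smp: "Ck_fun k \<psi>" for k using \<psi> by (simp add: C0_inf_def)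
    define v :: "real^'n" where "v = axis j 1"
    define h where "h x = \<phi> x $ i * \<psi> x" for x
    have smi: "Ck_fun k (\<lambda>x. \<phi> x $ i)" for k by (rule Ck_fun_bounded_linear[OF bounded_linear_vec_nth sm])
    have smh: "Ck_fun k h" for k unfolding h_def
      by (rule Ck_fun_bounded_bilinear[OF bounded_bilinear_mult smi smp])
    have h0: "h x = 0" if "x \<notin> K" for x using K(3)[OF that] by (simp add: h_def)
    have dh: "frechet_derivative h (at x) v = \<phi> x $ i * frechet_derivative \<psi> (at x) v + Jac \<phi> x $ i $ j * \<psi> x" for x
    proof -
      have "((\<lambda>x. \<phi> x $ i) has_derivative (\<lambda>w. (Jac \<phi> x *v w) $ i)) (at x)"
        by (rule bounded_linear.has_derivative[OF bounded_linear_vec_nth Jac_has_derivative[OF sm]])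
      moreover have "(\<psi> has_derivative frechet_derivative \<psi> (at x)) (at x)"
        using Ck_fun_Suc_has_derivative[OF smp] .
      ultimately have "(h has_derivative (\<lambda>w. \<phi> x $ i * frechet_derivative \<psi> (at x) w + (Jac \<phi> x *v w) $ i * \<psi> x)) (at x)"
        unfolding h_def by (rule has_derivative_mult)
      from fun_cong[OF frechet_derivative_at[OF this], of v, symmetric] show ?thesis
        by (simp add: v_def matrix_vector_mult_basis column_def)
    qed
    have "(LINT x|lebesgue. frechet_derivative h (at x) v) = 0"
      by (rule integral_directional_derivative_eq_0[OF _ _ K(1) h0]) (use smh[of "Suc 0"] in auto)
    moreover have "integrable lebesgue (\<lambda>x. \<phi> x $ i * frechet_derivative \<psi> (at x) v)"
    proof (rule integrable_continuous_compact_support[OF _ K(1)])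
      show "continuous_on UNIV (\<lambda>x. \<phi> x $ i * frechet_derivative \<psi> (at x) v)"
        using smi[of 0] smp[of "Suc 0"] by (intro continuous_on_mult) auto
    qed (simp add: K)
    moreover have "integrable lebesgue (\<lambda>x. Jac \<phi> x $ i $ j * \<psi> x)"
    proof (rule integrable_continuous_compact_support[OF _ K(1)])
      show "continuous_on UNIV (\<lambda>x. Jac \<phi> x $ i $ j * \<psi> x)"
        using continuous_on_Jac[OF sm] smp[of 0] by (intro continuous_on_mult continuous_on_component) auto
    qed (simp add: Jac_eq_0_outside[OF K(1,3)])
    ultimately have "(LINT x|lebesgue. \<phi> x $ i * frechet_derivative \<psi> (at x) v)
        = - (LINT x|lebesgue. Jac \<phi> x $ i $ j * \<psi> x)"
      unfolding dh by simp
    moreover have "(LINT x|lebesgue_on \<Omega>. \<phi> x $ i * frechet_derivative \<psi> (at x) v)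
        = (LINT x|lebesgue. \<phi> x $ i * frechet_derivative \<psi> (at x) v)"
    proof (rule integral_lebesgue_on_eq)
      show "\<phi> x $ i * frechet_derivative \<psi> (at x) v = 0" if "x \<notin> \<Omega>" for x
        using K(3)[OF contra_subsetD[OF K(2) that]] by simp
    qed (use \<Omega> in auto)
    moreover have "(LINT x|lebesgue_on \<Omega>. Jac \<phi> x $ i $ j * \<psi> x) = (LINT x|lebesgue. Jac \<phi> x $ i $ j * \<psi> x)"
    proof (rule integral_lebesgue_on_eq)
      show "Jac \<phi> x $ i $ j * \<psi> x = 0" if "x \<notin> \<Omega>" for x
        using Jac_eq_0_outside[OF K(1,3) contra_subsetD[OF K(2) that]] by simp
    qed (use \<Omega> in auto)
    ultimately show ?thesis by (simp add: v_def)
  qed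
  show ?thesis unfolding weak_jacobian_def
    using parts i\<phi> iJ by (auto intro!: integrable_lebesgue_onI simp: lmeasurable_compact fmeasurableD)
qed

lemma C0_inf_subset_W0_1_inf:
  fixes \<phi> :: "real^'n \<Rightarrow> real^'m"
  assumes \<Omega>: "open \<Omega>" and \<phi>: "\<phi> \<in> C0_inf \<Omega>"
  shows "\<phi> \<in> W0_1_inf \<Omega>"
proof -
  obtain K where K: "compact K" "K \<subseteq> \<Omega>" "\<And>x. x \<notin> K \<Longrightarrow> \<phi> x = 0" and sm: "\<And>k. Ck_fun k \<phi>"
    by (rule C0_infE[OF \<phi>], rule that)
  have S: "\<Omega> \<in> sets lebesgue" using \<Omega> by auto
  have c\<phi>: "continuous_on UNIV \<phi>" using sm[of 0] by simp
  have i\<phi>: "integrable (lebesgue_on \<Omega>) \<phi>"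
    by (rule integrable_lebesgue_onI[OF S integrable_continuous_compact_support[OF c\<phi> K(1,3)]])
  have iJ: "integrable (lebesgue_on \<Omega>) (Jac \<phi>)"
    by (rule integrable_lebesgue_onI[OF S integrable_continuous_compact_support[OF continuous_on_Jac[OF sm]
        K(1) Jac_eq_0_outside[OF K(1,3)]]])
  obtain C where C: "\<And>x. norm (\<phi> x) \<le> C"
    by (rule continuous_compact_support_bounded[OF c\<phi> K(1,3)], assumption, rule that)
  obtain C' where C': "\<And>x. norm (Jac \<phi> x) \<le> C'"
    by (rule continuous_compact_support_bounded[OF continuous_on_Jac[OF sm] K(1) Jac_eq_0_outside[OF K(1,3)]], assumption+, rule that)
  have "\<phi> \<in> L_inf \<Omega>" using i\<phi> C by (auto simp: L_inf_def)
  moreover have "Jac \<phi> \<in> L_inf \<Omega>" using iJ C' by (auto simp: L_inf_def)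
  moreover note weak = weak_jacobian_Jac[OF \<Omega> \<phi>]
  \<comment> \<open>The constant sequence \<phi> is an approximating sequence.\<close>
  moreover have "\<phi> \<in> W0_1_1 \<Omega>"
    unfolding W0_1_1_def mem_Collect_eq
    by (intro exI[of _ "Jac \<phi>"] conjI weak i\<phi> iJ exI[of _ "\<lambda>_. \<phi>"]) (simp_all add: \<phi>)
  ultimately show ?thesis by (auto simp: W0_1_inf_def W_1_inf_def)
qed

section \<open>Uniqueness of weak derivatives by blow-up\<close>

lemma AE_eq_0_if_integral_test_eq_0:
  fixes D :: "'a::euclidean_space \<Rightarrow> real"
  assumes \<Omega>: "open \<Omega>" and D: "\<And>K. compact K \<Longrightarrow> K \<subseteq> \<Omega> \<Longrightarrow> integrable (lebesgue_on K) D"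
    and test: "\<And>\<psi>. \<psi> \<in> C0_inf \<Omega> \<Longrightarrow> (LINT x|lebesgue. D x * \<psi> x) = 0"
  shows "AE x in lebesgue. x \<in> \<Omega> \<longrightarrow> D x = 0"
proof -
  obtain \<psi> :: "'a \<Rightarrow> real" where \<psi>: "\<And>k. Ck_fun k \<psi>" "\<And>x. 0 \<le> \<psi> x" "\<And>x. dist 0 x \<le> 1 \<Longrightarrow> \<psi> x = 1"
    "\<And>x. 2 * 1 \<le> dist 0 x \<Longrightarrow> \<psi> x = 0"
    by (rule smooth_cutoff[of 1 0], simp, rule that)
  have \<psi>c: "continuous_on UNIV \<psi>" using \<psi>(1)[of 0] by simp
  have \<psi>0: "\<psi> x = 0" if "x \<notin> cball 0 2" for x using that by (intro \<psi>(4)) auto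
  have \<psi>i: "integrable lebesgue \<psi>"
    by (rule integrable_continuous_compact_support[OF \<psi>c compact_cball \<psi>0])
  have \<psi>pos: "0 < (LINT x|lebesgue. \<psi> x)"
  proof -
    have "0 < measure lebesgue (cball (0::'a) 1)"
      using content_cball_pos[of 1 "0::'a"] by simp
    also have "\<dots> = (LINT x|lebesgue. indicator (cball (0::'a) 1) x)" by simp
    also have "\<dots> \<le> (LINT x|lebesgue. \<psi> x)"
    proof (rule integral_mono[OF _ \<psi>i])
      show "integrable lebesgue (indicat_real (cball (0::'a) 1))"
        by (rule lmeasurable_iff_integrable[THEN iffD1]) simp
      show "indicat_real (cball 0 1) x \<le> \<psi> x" for x
        using \<psi>(2,3)[of x] by (auto simp: indicator_def)
    qed
    finally show ?thesis .
  qed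
  \<comment> \<open>\<open>D\<close> is integrable only on compact subsets of \<Omega>, so it is
    truncated to a box. Testing with the bump \<psi> rescaled around x gives 0 for small \<epsilon>,
    while the blow-up limit is \<open>D x\<close> times the positive integral of \<psi>.\<close>
  have box: "AE x in lebesgue. x \<in> cbox a b \<longrightarrow> D x = 0" if ab: "cbox a b \<subseteq> \<Omega>" for a b
  proof -
    define g where "g x = indicator (cbox a b) x * D x" for x
    have gi: "integrable lebesgue g"
      using D[OF compact_cbox ab] by (subst (asm) integrable_restrict_space) (auto simp: g_def[abs_def])
    obtain \<epsilon> where \<epsilon>: "\<And>k. 0 < \<epsilon> k" "\<epsilon> \<longlonglongrightarrow> 0"
      and AE: "AE x in lebesgue. \<forall>r::nat. \<forall>Z. continuous_on UNIV Z \<longrightarrow>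
       (\<forall>k. integrable lebesgue (\<lambda>y. indicator (cball 0 (real r)) y * (g (x + \<epsilon> k *\<^sub>R y) * (Z y :: real)))) \<and>
       (\<lambda>k. LINT y|lebesgue. indicator (cball 0 (real r)) y * (g (x + \<epsilon> k *\<^sub>R y) * Z y)) \<longlonglongrightarrow>
         (LINT y|lebesgue. indicator (cball 0 (real r)) y * (g x * Z y))"
    \<comment> \<open>A linear integrand is its own Lipschitz bound, with weight \<open>g\<close>
      and M = 0; the bump takes the place of \<open>Z\<close>.\<close>
    proof (rule AE_blow_up_caratheodory[of "\<lambda>x s. g x * s" g])
      show "integrable lebesgue (\<lambda>x. g x * s)" for s using gi by simp
      show "integrable lebesgue g" by (rule gi)
      show "\<exists>M. \<forall>x. \<forall>\<zeta>\<in>cball 0 R. \<forall>\<zeta>'\<in>cball 0 R. \<bar>g x * \<zeta> - g x * \<zeta>'\<bar> \<le> (\<bar>g x\<bar> + M) * norm (\<zeta> - \<zeta>')" for R :: real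
        by (intro exI[of _ 0]) (simp flip: right_diff_distrib add: abs_mult)
    qed (rule that)
    \<comment> \<open>Dropping the null boundary leaves room for a ball around x inside the
      box.\<close>
    have "AE x in lebesgue. x \<notin> cbox a b - box a b"
      by (rule AE_not_in[OF negligible_frontier_interval[of a b, unfolded negligible_iff_null_sets]])
    with AE show ?thesis
    proof eventually_elim
      case (elim x)
      show ?case
      proof
        assume "x \<in> cbox a b"
        with elim have x: "x \<in> box a b" by blast
        obtain d where d: "d > 0" "ball x d \<subseteq> box a b"
          using x open_box[of a b] unfolding open_contains_ball by blast
        have lim: "(\<lambda>k. LINT y|lebesgue. indicator (cball 0 (real 2)) y * (g (x + \<epsilon> k *\<^sub>R y) * \<psi> y)) \<longlonglongrightarrow>
           (LINT y|lebesgue. indicator (cball 0 (real 2)) y * (g x * \<psi> y))"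
          and int: "\<And>k. integrable lebesgue (\<lambda>y. indicator (cball 0 (real 2)) y * (g (x + \<epsilon> k *\<^sub>R y) * \<psi> y))"
          using elim(1) \<psi>c by blast+
        have ind: "indicator (cball 0 (real 2)) y * (t * \<psi> y) = t * \<psi> y" for y t
          using \<psi>0[of y] by (auto simp: indicator_def)
        have "\<forall>\<^sub>F k in sequentially. \<epsilon> k < d / 3"
          using \<epsilon>(2) d(1) by (intro order_tendstoD) auto
        then have "\<forall>\<^sub>F k in sequentially. (LINT y|lebesgue. indicator (cball 0 (real 2)) y * (g (x + \<epsilon> k *\<^sub>R y) * \<psi> y)) = 0"
        proof eventually_elim
          case (elim k)
          define e where "e = \<epsilon> k"
          \<comment> \<open>The bump vanishes beyond radius 2, so its rescaled copy lives in
            \<open>cball x (2 * e)\<close>. As 2 e < d, this stays in the box, where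
            \<open>g\<close> and \<open>D\<close> coincide.\<close>
          have e: "0 < e" "e < d / 3" using \<epsilon>(1)[of k] elim by (auto simp: e_def)
          define \<psi>' where "\<psi>' z = \<psi> ((- (1/e)) *\<^sub>R x + (1/e) *\<^sub>R z)" for z
          have supp: "\<psi>' z = 0" if "z \<notin> cball x (2 * e)" for z
          proof -
            have "(- (1/e)) *\<^sub>R x + (1/e) *\<^sub>R z = (1/e) *\<^sub>R (z - x)" by (simp add: algebra_simps)
            then have "norm ((- (1/e)) *\<^sub>R x + (1/e) *\<^sub>R z) = dist x z / e"
              using e by (simp add: dist_norm norm_minus_commute)
            moreover have "2 < dist x z / e" using that e by (simp add: less_divide_eq)
            ultimately show ?thesis unfolding \<psi>'_def by (intro \<psi>0) simp
          qed
          have sub: "cball x (2 * e) \<subseteq> cbox a b"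
            using d(2) box_subset_cbox[of a b] e by (force simp: subset_eq)
          have "\<psi>' \<in> C0_inf \<Omega>"
          proof (rule C0_infI[OF _ supp compact_cball])
            show "Ck_fun j \<psi>'" for j unfolding \<psi>'_def by (rule Ck_fun_affine[OF \<psi>(1)])
            show "cball x (2 * e) \<subseteq> \<Omega>" using sub ab by blast
          qed
          from test[OF this] have "(LINT z|lebesgue. D z * \<psi>' z) = 0" .
          also have "(\<lambda>z. D z * \<psi>' z) = (\<lambda>z. indicator (cball 0 (real 2)) ((- (1/e)) *\<^sub>R x + (1/e) *\<^sub>R z) *
               (g (x + e *\<^sub>R ((- (1/e)) *\<^sub>R x + (1/e) *\<^sub>R z)) * \<psi> ((- (1/e)) *\<^sub>R x + (1/e) *\<^sub>R z)))"
          proof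
            fix z
            have "x + e *\<^sub>R ((- (1/e)) *\<^sub>R x + (1/e) *\<^sub>R z) = z"
              using e by (simp add: scaleR_diff_right)
            moreover have "g z * \<psi>' z = D z * \<psi>' z"
              using supp[of z] sub by (cases "z \<in> cball x (2 * e)") (auto simp: g_def)
            ultimately show "D z * \<psi>' z = indicator (cball 0 (real 2)) ((- (1/e)) *\<^sub>R x + (1/e) *\<^sub>R z) *
               (g (x + e *\<^sub>R ((- (1/e)) *\<^sub>R x + (1/e) *\<^sub>R z)) * \<psi> ((- (1/e)) *\<^sub>R x + (1/e) *\<^sub>R z))"
              unfolding ind by (auto simp: \<psi>'_def)
          qed
          finally show ?case
            using integral_lebesgue_affine[OF _ int[of k], of "1/e" "(- (1/e)) *\<^sub>R x"] e
            by (simp add: e_def)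
        qed
        then have "(\<lambda>k. LINT y|lebesgue. indicator (cball 0 (real 2)) y * (g (x + \<epsilon> k *\<^sub>R y) * \<psi> y)) \<longlonglongrightarrow> 0"
          by (rule tendsto_eventually)
        from LIMSEQ_unique[OF lim this] have "g x * (LINT y|lebesgue. \<psi> y) = 0"
          unfolding ind using \<psi>i by simp
        then show "D x = 0" using \<psi>pos \<open>x \<in> cbox a b\<close> by (simp add: g_def)
      qed
    qed
  qed
  \<comment> \<open>Countably many boxes exhaust \<Omega>, so the exceptional sets add up to a null
    set.\<close>
  obtain \<D> where \<D>: "countable \<D>" "\<D> \<subseteq> Pow \<Omega>" "\<And>X. X \<in> \<D> \<Longrightarrow> \<exists>a b. X = cbox a b" "\<Union>\<D> = \<Omega>"
    by (rule open_countable_Union_open_cbox[OF \<Omega>], rule that)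
  have "AE x in lebesgue. \<forall>X\<in>\<D>. x \<in> X \<longrightarrow> D x = 0"
  proof (rule AE_ball_countable'[OF _ \<D>(1)])
    fix X assume X: "X \<in> \<D>"
    obtain a b where "X = cbox a b" using \<D>(3)[OF X] by blast
    then show "AE x in lebesgue. x \<in> X \<longrightarrow> D x = 0" using box[of a b] X \<D>(2) by blast
  qed
  then show ?thesis by eventually_elim (use \<D>(4) in blast)
qed

lemma weak_jacobian_unique:
  fixes u :: "real^'n \<Rightarrow> real^'m"
  assumes \<Omega>: "open \<Omega>" and U: "weak_jacobian \<Omega> u U" and V: "weak_jacobian \<Omega> u V"
  shows "AE x in lebesgue. x \<in> \<Omega> \<longrightarrow> U x = V x"
proof -
  have comp: "integrable (lebesgue_on K) (\<lambda>x. W x $ i $ j)"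
    if "weak_jacobian \<Omega> u W" "compact K" "K \<subseteq> \<Omega>" for W :: "real^'n \<Rightarrow> real^'n^'m" and K i j
  proof -
    have "integrable (lebesgue_on K) W" using that by (auto simp: weak_jacobian_def)
    from integrable_bounded_linear[OF bounded_linear_vec_nth integrable_bounded_linear[OF bounded_linear_vec_nth this]]
    show ?thesis .
  qed
  have ij: "AE x in lebesgue. x \<in> \<Omega> \<longrightarrow> U x $ i $ j - V x $ i $ j = 0" for i j
  proof (rule AE_eq_0_if_integral_test_eq_0[OF \<Omega>])
    show "integrable (lebesgue_on K) (\<lambda>x. U x $ i $ j - V x $ i $ j)" if "compact K" "K \<subseteq> \<Omega>" for K
      using comp[OF U that] comp[OF V that] by (rule Bochner_Integration.integrable_diff)
    fix \<psi> :: "real^'n \<Rightarrow> real" assume \<psi>: "\<psi> \<in> C0_inf \<Omega>"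
    obtain K where K: "compact K" "K \<subseteq> \<Omega>" "\<And>x. x \<notin> K \<Longrightarrow> \<psi> x = 0" and sm: "\<And>k. Ck_fun k \<psi>"
      by (rule C0_infE[OF \<psi>], rule that)
    have \<psi>c: "continuous_on UNIV \<psi>" using sm[of 0] by simp
    have int: "integrable lebesgue (\<lambda>x. W x $ i $ j * \<psi> x)" if "weak_jacobian \<Omega> u W" for W :: "real^'n \<Rightarrow> real^'n^'m"
      by (rule integrable_mult_bounded_support[OF comp[OF that K(1,2)] K(1,3) \<psi>c])
    have on: "(LINT x|lebesgue_on \<Omega>. W x $ i $ j * \<psi> x) = (LINT x|lebesgue. W x $ i $ j * \<psi> x)" for W :: "real^'n \<Rightarrow> real^'n^'m"
    proof (rule integral_lebesgue_on_eq)
      show "W x $ i $ j * \<psi> x = 0" if "x \<notin> \<Omega>" for x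
        using K(3)[OF contra_subsetD[OF K(2) that]] by simp
    qed (use \<Omega> in auto)
    have eq: "(LINT x|lebesgue_on \<Omega>. u x $ i * frechet_derivative \<psi> (at x) (axis j 1)) =
        - (LINT x|lebesgue_on \<Omega>. W x $ i $ j * \<psi> x)" if "weak_jacobian \<Omega> u W" for W
      using that \<psi> by (simp add: weak_jacobian_def)
    have "(LINT x|lebesgue. U x $ i $ j * \<psi> x) = (LINT x|lebesgue. V x $ i $ j * \<psi> x)"
      using eq[OF U] eq[OF V] unfolding on by simp
    then show "(LINT x|lebesgue. (U x $ i $ j - V x $ i $ j) * \<psi> x) = 0"
      using int[OF U] int[OF V] by (simp add: left_diff_distrib)
  qed
  have "AE x in lebesgue. \<forall>i\<in>UNIV. \<forall>j\<in>UNIV. x \<in> \<Omega> \<longrightarrow> U x $ i $ j - V x $ i $ j = 0"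
    by (intro AE_finite_allI finite ij)
  then show ?thesis by eventually_elim (simp add: vec_eq_iff)
qed

text \<open>\<open>weak_D\<close> is an arbitrary choice, but uniqueness makes it agree almost
  everywhere with the classical Jacobian. Measurability of the other integrand is inherited through
  completeness.\<close>

lemma F_functional_C0_inf:
  fixes \<phi> :: "real^'n \<Rightarrow> real^'m"
  assumes \<Omega>: "open \<Omega>" and \<phi>: "\<phi> \<in> C0_inf \<Omega>"
    and meas: "(\<lambda>x. f x (Jac \<phi> x)) \<in> borel_measurable (lebesgue_on \<Omega>)"
  shows "F_functional \<Omega> f \<phi> = (LINT x|lebesgue_on \<Omega>. f x (Jac \<phi> x))"
proof -
  have S: "\<Omega> \<in> sets lebesgue" using \<Omega> by auto
  note weak = weak_jacobian_Jac[OF \<Omega> \<phi>]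
  have "weak_jacobian \<Omega> \<phi> (weak_D \<Omega> \<phi>)"
    unfolding weak_D_def by (rule someI[where P = "weak_jacobian \<Omega> \<phi>", OF weak])
  from weak_jacobian_unique[OF \<Omega> weak this]
  have AE: "AE x in lebesgue_on \<Omega>. f x (Jac \<phi> x) = f x (weak_D \<Omega> \<phi> x)"
    using S by (subst AE_restrict_space_iff) (auto elim!: eventually_mono)
  show ?thesis unfolding F_functional_def
    by (rule integral_cong_AE[symmetric, OF meas AE_lebesgue_measurable_cong[OF meas AE S] AE])
qed

subsection \<open>Gradients and difference quotients\<close>

text \<open>The derivative is represented by the vector of its values on the basis. Such a vector is
  unique, so the description in \<open>gradient\<close> denotes it.\<close>

lemma C1_fun_has_derivative:
  fixes h :: "'a::euclidean_space \<Rightarrow> real"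
  assumes "C1_fun h"
  shows "(h has_derivative (\<lambda>v. v \<bullet> gradient h \<xi>)) (at \<xi>)"
proof -
  obtain h' where h': "(h has_derivative h') (at \<xi>)"
    using assms unfolding C1_fun_def differentiable_def by blast
  define D where "D = (\<Sum>b\<in>Basis. h' b *\<^sub>R b)"
  have "h' v = v \<bullet> D" for v
  proof -
    have "linear h'" by (rule has_derivative_linear[OF h'])
    have "h' v = h' (\<Sum>b\<in>Basis. (v \<bullet> b) *\<^sub>R b)" by (simp add: euclidean_representation)
    also have "\<dots> = (\<Sum>b\<in>Basis. (v \<bullet> b) * h' b)"
      using \<open>linear h'\<close> by (simp add: linear_sum linear_cmul)
    also have "\<dots> = v \<bullet> D" by (simp add: D_def inner_sum_right mult.commute)
    finally show ?thesis .
  qed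
  then have "h' = (\<lambda>v. v \<bullet> D)" by (rule ext)
  with h' have D: "GDERIV h \<xi> :> D" by (simp add: gderiv_def)
  have "E = D" if "GDERIV h \<xi> :> E" for E
  proof -
    have "(\<lambda>v. v \<bullet> E) = (\<lambda>v. v \<bullet> D)"
      using that D unfolding gderiv_def by (rule has_derivative_unique)
    then show ?thesis by (metis vector_eq_ldot)
  qed
  with D have "gradient h \<xi> = D" unfolding gradient_def by (intro the_equality)
  with D show ?thesis by (simp add: gderiv_def)
qed

lemma C1_fun_continuous:
  fixes h :: "'a::euclidean_space \<Rightarrow> real"
  assumes "C1_fun h"
  shows "continuous_on UNIV h"
  using assms unfolding C1_fun_def
  by (intro continuous_at_imp_continuous_on ballI differentiable_imp_continuous_within) blast

lemma C1_fun_lipschitz: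
  fixes h :: "'a::euclidean_space \<Rightarrow> real"
  assumes "C1_fun h" "convex S" "\<And>\<xi>. \<xi> \<in> S \<Longrightarrow> norm (gradient h \<xi>) \<le> L" "\<xi> \<in> S" "\<xi>' \<in> S"
  shows "\<bar>h \<xi> - h \<xi>'\<bar> \<le> L * norm (\<xi> - \<xi>')"
proof -
  have "norm (h \<xi> - h \<xi>') \<le> L * norm (\<xi> - \<xi>')"
  proof (rule differentiable_bound[OF assms(2) _ _ assms(4,5)])
    fix x assume x: "x \<in> S"
    show "(h has_derivative (\<lambda>v. v \<bullet> gradient h x)) (at x within S)"
      by (rule has_derivative_at_withinI[OF C1_fun_has_derivative[OF assms(1)]])
    show "onorm (\<lambda>v. v \<bullet> gradient h x) \<le> L"
    proof (rule onorm_le)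
      fix v
      have "norm (v \<bullet> gradient h x) \<le> norm v * norm (gradient h x)"
        using Cauchy_Schwarz_ineq2 by simp
      also have "\<dots> \<le> norm v * L" by (intro mult_left_mono assms(3) x) simp
      finally show "norm (v \<bullet> gradient h x) \<le> L * norm v" by (simp add: mult.commute)
    qed
  qed
  then show ?thesis by simp
qed

lemma integral_Jac_eq_0:
  fixes \<eta> :: "real^'n \<Rightarrow> real^'m"
  assumes sm: "\<And>k. Ck_fun k \<eta>" and K: "compact K" "\<And>x. x \<notin> K \<Longrightarrow> \<eta> x = 0"
  shows "(LINT x|lebesgue. Jac \<eta> x) = 0"
proof -
  have int: "integrable lebesgue (Jac \<eta>)"
    by (rule integrable_continuous_compact_support[OF continuous_on_Jac[OF sm] K(1) Jac_eq_0_outside[OF K]])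
  have "(LINT x|lebesgue. Jac \<eta> x) $ i $ j = 0" for i j
  proof -
    have smi: "Ck_fun k (\<lambda>x. \<eta> x $ i)" for k by (rule Ck_fun_bounded_linear[OF bounded_linear_vec_nth sm])
    have eq: "frechet_derivative (\<lambda>x. \<eta> x $ i) (at x) (axis j 1) = Jac \<eta> x $ i $ j" for x
    proof -
      have "((\<lambda>x. \<eta> x $ i) has_derivative (\<lambda>w. (Jac \<eta> x *v w) $ i)) (at x)"
        by (rule bounded_linear.has_derivative[OF bounded_linear_vec_nth Jac_has_derivative[OF sm]])
      from fun_cong[OF frechet_derivative_at[OF this], of "axis j 1", symmetric] show ?thesis
        by (simp add: matrix_vector_mult_basis column_def)
    qed
    have "(LINT x|lebesgue. frechet_derivative (\<lambda>x. \<eta> x $ i) (at x) (axis j 1)) = 0"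
      by (rule integral_directional_derivative_eq_0[OF _ _ K(1)]) (use smi[of "Suc 0"] K(2) in auto)
    then have "(LINT x|lebesgue. Jac \<eta> x $ i $ j) = 0" unfolding eq .
    moreover have "(LINT x|lebesgue. Jac \<eta> x $ i $ j) = (LINT x|lebesgue. Jac \<eta> x $ i) $ j"
      by (rule integral_bounded_linear[OF bounded_linear_vec_nth integrable_bounded_linear[OF bounded_linear_vec_nth int]])
    moreover have "(LINT x|lebesgue. Jac \<eta> x $ i) = (LINT x|lebesgue. Jac \<eta> x) $ i"
      by (rule integral_bounded_linear[OF bounded_linear_vec_nth int])
    ultimately show ?thesis by simp
  qed
  then show ?thesis by (simp add: vec_eq_iff)
qed

text \<open>Only the chord joining the endpoints 0 and 1 enters, because the two one-sided slopes
  that matter are taken at exactly these points; full convexity of the integral as a function of t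
  is not assumed. Subtracting h(\<xi>) makes every integrand compactly supported.\<close>

lemma segment_convexity_imp_monotonicity:
  fixes h :: "real^'n^'m \<Rightarrow> real" and \<eta> :: "real^'n \<Rightarrow> real^'m"
  assumes h: "C1_fun h" and sm: "\<And>k. Ck_fun k \<eta>" and K: "compact K" "\<And>x. x \<notin> K \<Longrightarrow> \<eta> x = 0"
    and conv: "\<And>t. 0 \<le> t \<Longrightarrow> t \<le> 1 \<Longrightarrow>
      (LINT y|lebesgue. h (\<xi> + t *\<^sub>R Jac \<eta> y) - (1 - t) * h \<xi> - t * h (\<xi> + Jac \<eta> y)) \<le> 0"
  shows "0 \<le> (LINT y|lebesgue. h (\<xi> + Jac \<eta> y) - h \<xi>)"
    and "0 \<le> (LINT y|lebesgue. gradient h (\<xi> + Jac \<eta> y) \<bullet> Jac \<eta> y)"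
proof -
  define J where "J = Jac \<eta>"
  have J0: "J y = 0" if "y \<notin> K" for y unfolding J_def by (rule Jac_eq_0_outside[OF K that])
  have Jc: "continuous_on UNIV J" unfolding J_def by (rule continuous_on_Jac[OF sm])
  have Jint: "integrable lebesgue J" by (rule integrable_continuous_compact_support[OF Jc K(1) J0])
  have hc: "continuous_on UNIV h" by (rule C1_fun_continuous[OF h])
  have gc: "continuous_on UNIV (gradient h)" using h by (simp add: C1_fun_def)
  have comp: "continuous_on UNIV (\<lambda>y. g (\<xi> + t *\<^sub>R J y))" if "continuous_on UNIV g"
    for g :: "real^'n^'m \<Rightarrow> 'b::real_normed_vector" and t
    by (rule continuous_on_compose2[OF that]) (auto intro!: continuous_intros Jc)
  obtain C where C: "0 < C" "\<And>y. norm (J y) \<le> C"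
    by (rule continuous_compact_support_bounded[OF Jc K(1) J0], assumption, rule that)
  \<comment> \<open>A compact convex set containing every segment from \<xi> to \<xi> +
    \<open>J y\<close>. The bound of the gradient on it gives the dominating function
    \<open>L * norm (J y)\<close> for the difference quotients.\<close>
  define S where "S = cball (0 :: real^'n^'m) (norm \<xi> + C)"
  have "compact (gradient h ` S)" unfolding S_def
    by (rule compact_continuous_image[OF continuous_on_subset[OF gc subset_UNIV] compact_cball])
  then have "bounded (gradient h ` S)" by (rule compact_imp_bounded)
  then obtain L where L: "0 < L" "\<forall>y\<in>gradient h ` S. norm y \<le> L" unfolding bounded_pos by blast
  have S: "\<xi> + t *\<^sub>R J y \<in> S" if "0 \<le> t" "t \<le> 1" for t y
  proof -
    have "norm (\<xi> + t *\<^sub>R J y) \<le> norm \<xi> + norm (t *\<^sub>R J y)" by (rule norm_triangle_ineq)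
    also have "norm (t *\<^sub>R J y) \<le> 1 * C" unfolding norm_scaleR
      by (intro mult_mono) (use that C in auto)
    finally show ?thesis by (simp add: S_def)
  qed
  have lip: "\<bar>h \<zeta> - h \<zeta>'\<bar> \<le> L * norm (\<zeta> - \<zeta>')" if "\<zeta> \<in> S" "\<zeta>' \<in> S" for \<zeta> \<zeta>'
    by (rule C1_fun_lipschitz[OF h _ _ that]) (use L in \<open>auto simp: S_def\<close>)
  define P where "P t y = h (\<xi> + t *\<^sub>R J y) - h \<xi>" for t y
  define \<Psi> where "\<Psi> t = (LINT y|lebesgue. P t y)" for t
  have Pint: "integrable lebesgue (P t)" for t
  proof (rule integrable_continuous_compact_support[OF _ K(1)])
    show "continuous_on UNIV (P t)"
      unfolding P_def using comp[OF hc] by (intro continuous_on_diff continuous_on_const)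
  qed (simp add: P_def J0)
  have chord: "\<Psi> t \<le> t * \<Psi> 1" if "0 \<le> t" "t \<le> 1" for t
  proof -
    have "(LINT y|lebesgue. P t y - t * P 1 y) \<le> 0"
      using conv[OF that] by (simp add: P_def J_def algebra_simps)
    then show ?thesis using Pint by (simp add: \<Psi>_def)
  qed
  \<comment> \<open>The increments may have either sign as long as t + \<sigma> stays in [0,1], so
    that one statement yields the right derivative at 0 and the left derivative at 1.\<close>
  have deriv: "(\<lambda>n. (\<Psi> (t + \<sigma> n) - \<Psi> t) / \<sigma> n) \<longlonglongrightarrow> (LINT y|lebesgue. J y \<bullet> gradient h (\<xi> + t *\<^sub>R J y))"
    if \<sigma>: "\<sigma> \<longlonglongrightarrow> 0" "\<And>n. \<sigma> n \<noteq> 0" "\<And>n. 0 \<le> t + \<sigma> n" "\<And>n. t + \<sigma> n \<le> 1" and t: "0 \<le> t" "t \<le> 1"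
    for t and \<sigma> :: "nat \<Rightarrow> real"
  proof -
    have "(\<lambda>n. LINT y|lebesgue. (P (t + \<sigma> n) y - P t y) / \<sigma> n) \<longlonglongrightarrow>
        (LINT y|lebesgue. J y \<bullet> gradient h (\<xi> + t *\<^sub>R J y))"
    proof (rule integral_dominated_convergence)
      have "continuous_on UNIV (\<lambda>y. J y \<bullet> gradient h (\<xi> + t *\<^sub>R J y))"
        by (intro continuous_on_inner Jc comp gc)
      from integrable_continuous_compact_support[OF this K(1)]
      show "(\<lambda>y. J y \<bullet> gradient h (\<xi> + t *\<^sub>R J y)) \<in> borel_measurable lebesgue"
        by (rule borel_measurable_integrable) (simp add: J0)
      show "(\<lambda>y. (P (t + \<sigma> n) y - P t y) / \<sigma> n) \<in> borel_measurable lebesgue" for n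
        using Pint by (intro borel_measurable_divide borel_measurable_diff borel_measurable_const borel_measurable_integrable)
      show "integrable lebesgue (\<lambda>y. L * norm (J y))" using Jint by simp
      show "AE y in lebesgue. norm ((P (t + \<sigma> n) y - P t y) / \<sigma> n) \<le> L * norm (J y)" for n
      proof (rule AE_I2)
        fix y
        have "\<bar>h (\<xi> + (t + \<sigma> n) *\<^sub>R J y) - h (\<xi> + t *\<^sub>R J y)\<bar> \<le> L * norm ((\<xi> + (t + \<sigma> n) *\<^sub>R J y) - (\<xi> + t *\<^sub>R J y))"
          by (intro lip S \<sigma> t)
        also have "(\<xi> + (t + \<sigma> n) *\<^sub>R J y) - (\<xi> + t *\<^sub>R J y) = \<sigma> n *\<^sub>R J y" by (simp add: algebra_simps)
        finally show "norm ((P (t + \<sigma> n) y - P t y) / \<sigma> n) \<le> L * norm (J y)"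
          using \<sigma>(2)[of n] by (simp add: P_def divide_le_eq mult_ac)
      qed
      show "AE y in lebesgue. (\<lambda>n. (P (t + \<sigma> n) y - P t y) / \<sigma> n) \<longlonglongrightarrow> J y \<bullet> gradient h (\<xi> + t *\<^sub>R J y)"
      proof (rule AE_I2)
        fix y
        have "((\<lambda>r. h (\<xi> + r *\<^sub>R J y)) has_derivative (\<lambda>r. (r *\<^sub>R J y) \<bullet> gradient h (\<xi> + t *\<^sub>R J y))) (at t)"
          by (rule has_derivative_compose[OF _ C1_fun_has_derivative[OF h]]) (auto intro!: derivative_eq_intros)
        then have "((\<lambda>r. h (\<xi> + r *\<^sub>R J y)) has_real_derivative (J y \<bullet> gradient h (\<xi> + t *\<^sub>R J y))) (at t)"
          by (simp add: has_field_derivative_def mult_commute_abs)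
        then have "((\<lambda>r. (h (\<xi> + (t + r) *\<^sub>R J y) - h (\<xi> + t *\<^sub>R J y)) / r) \<longlongrightarrow> J y \<bullet> gradient h (\<xi> + t *\<^sub>R J y)) (at 0)"
          by (simp add: DERIV_def)
        moreover have "filterlim \<sigma> (at 0) sequentially"
          using \<sigma> by (simp add: filterlim_at)
        ultimately have "(\<lambda>n. (h (\<xi> + (t + \<sigma> n) *\<^sub>R J y) - h (\<xi> + t *\<^sub>R J y)) / \<sigma> n) \<longlonglongrightarrow> J y \<bullet> gradient h (\<xi> + t *\<^sub>R J y)"
          by (rule filterlim_compose)
        then show "(\<lambda>n. (P (t + \<sigma> n) y - P t y) / \<sigma> n) \<longlonglongrightarrow> J y \<bullet> gradient h (\<xi> + t *\<^sub>R J y)"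
          by (simp add: P_def)
      qed
    qed
    then show ?thesis using Pint by (simp add: \<Psi>_def)
  qed
  define s where "s n = 1 / (real n + 1)" for n
  have s: "0 < s n" "s n \<le> 1" for n by (auto simp: s_def)
  have s0: "s \<longlonglongrightarrow> 0"
    unfolding s_def using LIMSEQ_inverse_real_of_nat by (simp add: inverse_eq_divide add.commute)
  have s0': "(\<lambda>n. - s n) \<longlonglongrightarrow> 0" using tendsto_minus[OF s0] by simp
  have \<Psi>0: "\<Psi> 0 = 0" by (simp add: \<Psi>_def P_def)
  have "(LINT y|lebesgue. J y \<bullet> gradient h \<xi>) = 0"
    using integral_Jac_eq_0[OF sm K] Jint by (simp add: J_def)
  then have "(\<lambda>n. \<Psi> (s n) / s n) \<longlonglongrightarrow> 0"
    using deriv[of s 0] s0 s \<Psi>0 by (simp add: less_imp_le less_imp_neq[symmetric])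
  moreover have "\<Psi> (s n) / s n \<le> \<Psi> 1" for n
    using chord[of "s n"] s[of n] by (simp add: divide_le_eq mult.commute)
  ultimately have \<Psi>1: "0 \<le> \<Psi> 1" by (intro LIMSEQ_le_const2) auto
  then show "0 \<le> (LINT y|lebesgue. h (\<xi> + Jac \<eta> y) - h \<xi>)" by (simp add: \<Psi>_def P_def J_def)
  \<comment> \<open>Left difference quotients at 1. Since \<Psi> 1 is already known to be
    nonnegative, the chord bound gives \<Psi> (1 - s) \<le> \<Psi> 1, so the quotients are
    nonnegative.\<close>
  have "(\<lambda>n. (\<Psi> (1 + - s n) - \<Psi> 1) / - s n) \<longlonglongrightarrow> (LINT y|lebesgue. J y \<bullet> gradient h (\<xi> + 1 *\<^sub>R J y))"
    by (rule deriv[OF s0']) (use s in \<open>auto simp: less_imp_le less_imp_neq[symmetric]\<close>)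
  moreover have "0 \<le> (\<Psi> (1 + - s n) - \<Psi> 1) / - s n" for n
  proof -
    have "\<Psi> (1 + - s n) \<le> (1 + - s n) * \<Psi> 1" using s[of n] by (intro chord) auto
    also have "\<dots> \<le> 1 * \<Psi> 1" using s[of n] \<Psi>1 by (intro mult_right_mono) auto
    finally show ?thesis using s(1)[of n] by (simp add: divide_nonpos_pos)
  qed
  ultimately have "0 \<le> (LINT y|lebesgue. J y \<bullet> gradient h (\<xi> + 1 *\<^sub>R J y))"
    by (intro LIMSEQ_le_const) auto
  then show "0 \<le> (LINT y|lebesgue. gradient h (\<xi> + Jac \<eta> y) \<bullet> Jac \<eta> y)"
    by (simp add: J_def inner_commute)
qed

subsection \<open>Localisation of the convexity inequality\<close>

text \<open>Off the ball where the gradient of u equals \<xi>, the perturbation w has zero gradient,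
  and the combination of the three integrands vanishes there because 1 - (1 - t) - t = 0. The global
  inequality therefore reduces to one on that ball, which the rescaling maps to the fixed support of
  \<eta>.\<close>

lemma blow_up_convexity:
  fixes F :: "real^'n \<Rightarrow> real^'n^'m \<Rightarrow> real" and \<eta> :: "real^'n \<Rightarrow> real^'m"
  assumes \<Omega>: "open \<Omega>" "x0 \<in> \<Omega>"
    and int: "\<And>Z. continuous_on UNIV Z \<Longrightarrow> bounded (range Z) \<Longrightarrow> integrable lebesgue (\<lambda>x. F x (Z x))"
    and conv: "\<And>u w. u \<in> C0_inf \<Omega> \<Longrightarrow> w \<in> C0_inf \<Omega> \<Longrightarrow>
      (LINT x|lebesgue. F x (Jac u x + t *\<^sub>R Jac w x))
        \<le> (1 - t) * (LINT x|lebesgue. F x (Jac u x)) + t * (LINT x|lebesgue. F x (Jac u x + Jac w x))"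
    and sm: "\<And>k. Ck_fun k \<eta>" and K: "compact K" "\<And>x. x \<notin> K \<Longrightarrow> \<eta> x = 0"
  shows "\<exists>d>0. \<forall>e. 0 < e \<and> e < d \<longrightarrow>
    (LINT y|lebesgue. F (x0 + e *\<^sub>R y) (\<xi> + t *\<^sub>R Jac \<eta> y) - (1 - t) * F (x0 + e *\<^sub>R y) \<xi>
       - t * F (x0 + e *\<^sub>R y) (\<xi> + Jac \<eta> y)) \<le> 0"
proof -
  obtain r0 where r0: "r0 > 0" "cball x0 r0 \<subseteq> \<Omega>" using \<Omega> open_contains_cball by blast
  \<comment> \<open>The cutoff equals 1 up to radius \<open>r\<close> and vanishes only from
    \<open>2 * r\<close> on, so both balls must fit into \<Omega>.\<close>
  define r where "r = r0 / 2"
  have r: "r > 0" "cball x0 (2 * r) \<subseteq> \<Omega>" using r0 by (auto simp: r_def)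
  obtain \<zeta> :: "real^'n \<Rightarrow> real" where \<zeta>: "\<And>k. Ck_fun k \<zeta>" "\<And>x. 0 \<le> \<zeta> x" "\<And>x. dist x0 x \<le> r \<Longrightarrow> \<zeta> x = 1"
    "\<And>x. 2 * r \<le> dist x0 x \<Longrightarrow> \<zeta> x = 0"
    by (rule smooth_cutoff[OF r(1), of x0], rule that)
  obtain \<rho> where \<rho>: "\<rho> > 0" "\<forall>y\<in>K. norm y \<le> \<rho>"
    using compact_imp_bounded[OF K(1)] unfolding bounded_pos by blast
  define u where "u x = \<zeta> x *\<^sub>R (\<xi> *v (- x0 + 1 *\<^sub>R x))" for x
  have usm: "Ck_fun k u" for k unfolding u_def
    by (rule Ck_fun_bounded_bilinear[OF bounded_bilinear_scaleR \<zeta>(1)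
          Ck_fun_bounded_linear[OF matrix_vector_mul_bounded_linear Ck_fun_affine[OF Ck_fun_ident]]])
  have u0: "u x = 0" if "x \<notin> cball x0 (2 * r)" for x
    using that by (simp add: u_def \<zeta>(4))
  have uC: "u \<in> C0_inf \<Omega>" by (rule C0_infI[OF usm u0 compact_cball r(2)])
  have Ju: "Jac u x = \<xi>" if "x \<in> ball x0 r" for x
  proof (rule Jac_eqI)
    have "((\<lambda>x. \<xi> *v (x - x0)) has_derivative (\<lambda>h. \<xi> *v h)) (at x)"
      by (rule bounded_linear.has_derivative[OF matrix_vector_mul_bounded_linear]) (auto intro!: derivative_eq_intros)
    then show "(u has_derivative (\<lambda>h. \<xi> *v h)) (at x)"
      by (rule has_derivative_transform_within_open[OF _ open_ball that]) (simp add: u_def \<zeta>(3))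
  qed
  have Jbd: "continuous_on UNIV (Jac v)" "bounded (range (Jac v))" if v: "v \<in> C0_inf \<Omega>" for v :: "real^'n \<Rightarrow> real^'m"
  proof -
    obtain K' where K': "compact K'" "K' \<subseteq> \<Omega>" "\<And>x. x \<notin> K' \<Longrightarrow> v x = 0" and smv: "\<And>k. Ck_fun k v"
      by (rule C0_infE[OF v], rule that)
    show c: "continuous_on UNIV (Jac v)" by (rule continuous_on_Jac[OF smv])
    obtain C where "0 < C" "\<And>x. norm (Jac v x) \<le> C"
      by (rule continuous_compact_support_bounded[OF c K'(1) Jac_eq_0_outside[OF K'(1,3)]], assumption+, rule that)
    then show "bounded (range (Jac v))" unfolding bounded_iff by blast
  qed
  show ?thesis
  proof (intro exI[of _ "r / \<rho>"] conjI allI impI)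
    \<comment> \<open>With \<open>\<rho>\<close> bounding the support of \<eta>, the condition e < r
      / \<rho> keeps the support of w inside \<open>ball x0 r\<close>.\<close>
    show "0 < r / \<rho>" using r \<rho> by simp
    fix e assume e': "0 < e \<and> e < r / \<rho>"
    then have e: "0 < e" "e * \<rho> < r" using \<rho> by (auto simp: less_divide_eq)
    define T where "T x = (- (1/e)) *\<^sub>R x0 + (1/e) *\<^sub>R x" for x
    have T: "x0 + e *\<^sub>R T x = x" for x using e by (simp add: T_def scaleR_diff_right)
    have T': "T (x0 + e *\<^sub>R y) = y" for y using e by (simp add: T_def scaleR_add_right)
    \<comment> \<open>The prefactor e cancels the 1/e produced by the inner scaling: w becomes
      small, but its Jacobian takes the same values as that of \<eta>.\<close>
    define w where "w x = e *\<^sub>R \<eta> (T x)" for x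
    have wsm: "Ck_fun k w" for k unfolding w_def T_def
      by (rule Ck_fun_bounded_linear[OF bounded_linear_scaleR_right Ck_fun_affine[OF sm]])
    have far: "T x \<notin> K" if "x \<notin> ball x0 r" for x
    proof
      assume "T x \<in> K"
      then have "norm (T x) \<le> \<rho>" using \<rho> by blast
      then have "e * norm (T x) \<le> e * \<rho>" using e by (intro mult_left_mono) auto
      moreover have "dist x0 x = e * norm (T x)"
        by (subst T[of x, symmetric]) (use e in \<open>simp add: dist_norm\<close>)
      ultimately have "dist x0 x < r" using e by linarith
      then show False using that by simp
    qed
    have wC: "w \<in> C0_inf \<Omega>"
    proof (rule C0_infI[OF wsm _ compact_cball r(2)])
      show "w x = 0" if "x \<notin> cball x0 (2 * r)" for x
        using far[of x] K(2)[of "T x"] that r(1) by (simp add: w_def)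
    qed
    have Jw: "Jac w x = Jac \<eta> (T x)" for x
    proof (rule Jac_eqI)
      have "(T has_derivative (\<lambda>h. (1/e) *\<^sub>R h)) (at x)"
        unfolding T_def by (auto intro!: derivative_eq_intros)
      from has_derivative_compose[OF this Jac_has_derivative[OF sm]]
      have "((\<lambda>x. \<eta> (T x)) has_derivative (\<lambda>h. Jac \<eta> (T x) *v ((1/e) *\<^sub>R h))) (at x)" .
      then have "(w has_derivative (\<lambda>h. e *\<^sub>R (Jac \<eta> (T x) *v ((1/e) *\<^sub>R h)))) (at x)"
        unfolding w_def by (rule has_derivative_scaleR_right)
      moreover have "e *\<^sub>R (Jac \<eta> (T x) *v ((1/e) *\<^sub>R h)) = Jac \<eta> (T x) *v h" for h
        using e by (simp add: matrix_vector_mult_scaleR)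
      ultimately show "(w has_derivative (\<lambda>h. Jac \<eta> (T x) *v h)) (at x)" by simp
    qed
    have Jsum: "continuous_on UNIV (\<lambda>x. Jac u x + a *\<^sub>R Jac w x)" "bounded (range (\<lambda>x. Jac u x + a *\<^sub>R Jac w x))" for a
      using Jbd[OF uC] Jbd[OF wC]
      by (auto intro!: continuous_intros bounded_plus_comp bounded_scaleR_comp)
    have i0: "integrable lebesgue (\<lambda>x. F x (Jac u x))" by (rule int[OF Jbd[OF uC]])
    have it: "integrable lebesgue (\<lambda>x. F x (Jac u x + t *\<^sub>R Jac w x))" by (rule int[OF Jsum])
    have i1: "integrable lebesgue (\<lambda>x. F x (Jac u x + Jac w x))" using int[OF Jsum[of 1]] by simp
    \<comment> \<open>Written with \<xi> instead of the Jacobian of u, since the two versions agree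
      on the ball and both vanish off it. This version rescales to the desired integrand.\<close>
    define H where "H x = F x (\<xi> + t *\<^sub>R Jac \<eta> (T x)) - (1 - t) * F x \<xi> - t * F x (\<xi> + Jac \<eta> (T x))" for x
    have H_eq: "H = (\<lambda>x. F x (Jac u x + t *\<^sub>R Jac w x) - (1 - t) * F x (Jac u x) - t * F x (Jac u x + Jac w x))"
    proof
      fix x
      show "H x = F x (Jac u x + t *\<^sub>R Jac w x) - (1 - t) * F x (Jac u x) - t * F x (Jac u x + Jac w x)"
      proof (cases "x \<in> ball x0 r")
        case True
        then show ?thesis by (simp add: H_def Jw Ju)
      next
        case False
        then have "Jac \<eta> (T x) = 0" by (intro Jac_eq_0_outside[OF K] far)
        then show ?thesis by (simp add: H_def Jw algebra_simps)
      qed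
    qed
    have Hint: "integrable lebesgue H" unfolding H_eq using i0 i1 it by simp
    have "(LINT x|lebesgue. H x) \<le> 0"
      unfolding H_eq using i0 i1 it conv[OF uC wC] by simp
    moreover have "(LINT x|lebesgue. H x) = \<bar>e\<bar> ^ DIM(real^'n) *\<^sub>R (LINT y|lebesgue. H (x0 + e *\<^sub>R y))"
      using e by (intro integral_lebesgue_affine Hint) auto
    \<comment> \<open>The Jacobian factor of the substitution is positive and can be divided
      out.\<close>
    ultimately have "(LINT y|lebesgue. H (x0 + e *\<^sub>R y)) \<le> 0"
      using e zero_less_power[OF e(1), of "CARD('n)"] by (auto simp: mult_le_0_iff)
    then show "(LINT y|lebesgue. F (x0 + e *\<^sub>R y) (\<xi> + t *\<^sub>R Jac \<eta> y) - (1 - t) * F (x0 + e *\<^sub>R y) \<xi>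
       - t * F (x0 + e *\<^sub>R y) (\<xi> + Jac \<eta> y)) \<le> 0"
      by (simp add: H_def T')
  qed
qed

text \<open>The sequence and the null set depend on \<open>F\<close> alone, so all quantifiers stand
  inside the almost-everywhere statement. \<open>G\<close> need not be related to \<Omega>: \<eta>
  is shrunk into \<Omega> before the inequality is applied.\<close>

lemma AE_segment_convexity:
  fixes F :: "real^'n \<Rightarrow> real^'n^'m \<Rightarrow> real"
  assumes \<Omega>: "open \<Omega>"
    and c: "integrable lebesgue c"
    and lip: "\<And>R. \<exists>M. \<forall>x. \<forall>\<zeta>\<in>cball 0 R. \<forall>\<zeta>'\<in>cball 0 R.
                \<bar>F x \<zeta> - F x \<zeta>'\<bar> \<le> (\<bar>c x\<bar> + M) * norm (\<zeta> - \<zeta>')"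
    and cont: "\<And>x. continuous_on UNIV (F x)"
    and int: "\<And>Z. continuous_on UNIV Z \<Longrightarrow> bounded (range Z) \<Longrightarrow> integrable lebesgue (\<lambda>x. F x (Z x))"
    and conv: "\<And>u w t. u \<in> C0_inf \<Omega> \<Longrightarrow> w \<in> C0_inf \<Omega> \<Longrightarrow> 0 \<le> t \<Longrightarrow> t \<le> 1 \<Longrightarrow>
      (LINT x|lebesgue. F x (Jac u x + t *\<^sub>R Jac w x))
        \<le> (1 - t) * (LINT x|lebesgue. F x (Jac u x)) + t * (LINT x|lebesgue. F x (Jac u x + Jac w x))"
  shows "AE x in lebesgue. x \<in> \<Omega> \<longrightarrow> (\<forall>G \<xi> t. \<forall>\<eta>\<in>C0_inf G. 0 \<le> t \<and> t \<le> 1 \<longrightarrow>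
      (LINT y|lebesgue. F x (\<xi> + t *\<^sub>R Jac \<eta> y) - (1 - t) * F x \<xi> - t * F x (\<xi> + Jac \<eta> y)) \<le> 0)"
proof -
  have Fint: "integrable lebesgue (\<lambda>x. F x \<zeta>)" for \<zeta> by (rule int) auto
  obtain \<epsilon> where \<epsilon>: "\<And>k. 0 < \<epsilon> k" "\<epsilon> \<longlonglongrightarrow> 0"
    and AE: "AE x in lebesgue. \<forall>r::nat. \<forall>Z. continuous_on UNIV Z \<longrightarrow>
       (\<forall>k. integrable lebesgue (\<lambda>y. indicator (cball 0 (real r)) y * F (x + \<epsilon> k *\<^sub>R y) (Z y))) \<and>
       (\<lambda>k. LINT y|lebesgue. indicator (cball 0 (real r)) y * F (x + \<epsilon> k *\<^sub>R y) (Z y)) \<longlonglongrightarrow>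
         (LINT y|lebesgue. indicator (cball 0 (real r)) y * F x (Z y))"
    by (rule AE_blow_up_caratheodory[OF Fint c lip], rule that)
  from AE show ?thesis
  proof eventually_elim
    case (elim x)
    show ?case
    proof (intro impI allI ballI, elim conjE)
      fix G \<xi> t and \<eta> :: "real^'n \<Rightarrow> real^'m"
      assume x: "x \<in> \<Omega>" and \<eta>: "\<eta> \<in> C0_inf G" and t: "0 \<le> t" "t \<le> (1::real)"
      obtain K where K: "compact K" "K \<subseteq> G" "\<And>x. x \<notin> K \<Longrightarrow> \<eta> x = 0" and sm: "\<And>k. Ck_fun k \<eta>"
        by (rule C0_infE[OF \<eta>], rule that)
      define J where "J = Jac \<eta>"
      have Jc: "continuous_on UNIV J" unfolding J_def by (rule continuous_on_Jac[OF sm])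
      obtain \<rho> where \<rho>: "\<rho> > 0" "\<forall>y\<in>K. norm y \<le> \<rho>"
        using compact_imp_bounded[OF K(1)] unfolding bounded_pos by blast
      obtain r :: nat where r: "\<rho> \<le> real r" using real_arch_simple by blast
      let ?I = "indicat_real (cball (0::real^'n) (real r))"
      have J0: "J y = 0" if "y \<notin> cball 0 (real r)" for y
      proof -
        have "y \<notin> K" using that \<rho>(2) r order_trans by (metis mem_cball_0)
        then show ?thesis unfolding J_def by (intro Jac_eq_0_outside[of K \<eta>] K)
      qed
      have Zc: "continuous_on UNIV (\<lambda>y. \<xi> + a *\<^sub>R J y)" for a by (intro continuous_intros Jc)
      have lim: "(\<lambda>k. LINT y|lebesgue. ?I y * F (x + \<epsilon> k *\<^sub>R y) (\<xi> + a *\<^sub>R J y)) \<longlonglongrightarrow>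
          (LINT y|lebesgue. ?I y * F x (\<xi> + a *\<^sub>R J y))"
        and intk: "\<And>k. integrable lebesgue (\<lambda>y. ?I y * F (x + \<epsilon> k *\<^sub>R y) (\<xi> + a *\<^sub>R J y))" for a
        using elim Zc[of a] by blast+
      have int0: "integrable lebesgue (\<lambda>y. ?I y * F x (\<xi> + a *\<^sub>R J y))" for a
      proof -
        have cc: "continuous_on UNIV (\<lambda>y. F x (\<xi> + a *\<^sub>R J y))"
          by (rule continuous_on_compose2[OF cont Zc]) simp
        have "integrable lborel (\<lambda>y. ?I y *\<^sub>R F x (\<xi> + a *\<^sub>R J y))"
          by (rule borel_integrable_compact[OF compact_cball continuous_on_subset[OF cc subset_UNIV]])
        then show ?thesis using borel_measurable_integrable by (subst integrable_completion) auto
      qed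
      \<comment> \<open>Blow-up limits are known only over balls. The indicator can be inserted into
        the combination, which vanishes where \<open>J y = 0\<close>, and then allows the three
        terms to be integrated separately.\<close>
      have I: "?I y * (a y (\<xi> + t *\<^sub>R J y) - (1 - t) * a y \<xi> - t * a y (\<xi> + J y)) =
          a y (\<xi> + t *\<^sub>R J y) - (1 - t) * a y \<xi> - t * a y (\<xi> + J y)"
        for a :: "real^'n \<Rightarrow> real^'n^'m \<Rightarrow> real" and y
        using J0[of y] by (cases "y \<in> cball 0 (real r)") (simp_all add: algebra_simps)
      have comb: "(LINT y|lebesgue. a y (\<xi> + t *\<^sub>R J y) - (1 - t) * a y \<xi> - t * a y (\<xi> + J y)) =
          (LINT y|lebesgue. ?I y * a y (\<xi> + t *\<^sub>R J y)) - (1 - t) * (LINT y|lebesgue. ?I y * a y (\<xi> + 0 *\<^sub>R J y))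
          - t * (LINT y|lebesgue. ?I y * a y (\<xi> + 1 *\<^sub>R J y))"
        if "\<And>s. integrable lebesgue (\<lambda>y. ?I y * a y (\<xi> + s *\<^sub>R J y))" for a :: "real^'n \<Rightarrow> real^'n^'m \<Rightarrow> real"
      proof -
        have "(LINT y|lebesgue. a y (\<xi> + t *\<^sub>R J y) - (1 - t) * a y \<xi> - t * a y (\<xi> + J y)) =
          (LINT y|lebesgue. ?I y * a y (\<xi> + t *\<^sub>R J y) - (1 - t) * (?I y * a y (\<xi> + 0 *\<^sub>R J y))
            - t * (?I y * a y (\<xi> + 1 *\<^sub>R J y)))"
          by (subst I[symmetric]) (simp add: algebra_simps)
        also have "\<dots> = (LINT y|lebesgue. ?I y * a y (\<xi> + t *\<^sub>R J y)) - (1 - t) * (LINT y|lebesgue. ?I y * a y (\<xi> + 0 *\<^sub>R J y))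
          - t * (LINT y|lebesgue. ?I y * a y (\<xi> + 1 *\<^sub>R J y))"
          using that[of t] that[of 0] that[of 1]
          by (simp only: Bochner_Integration.integral_diff Bochner_Integration.integrable_diff
              integrable_mult_right integral_mult_right_zero)
        finally show ?thesis .
      qed
      have tends: "(\<lambda>k. LINT y|lebesgue. F (x + \<epsilon> k *\<^sub>R y) (\<xi> + t *\<^sub>R J y) - (1 - t) * F (x + \<epsilon> k *\<^sub>R y) \<xi>
            - t * F (x + \<epsilon> k *\<^sub>R y) (\<xi> + J y)) \<longlonglongrightarrow>
          (LINT y|lebesgue. F x (\<xi> + t *\<^sub>R J y) - (1 - t) * F x \<xi> - t * F x (\<xi> + J y))"
        unfolding comb[of "\<lambda>y. F (x + \<epsilon> k *\<^sub>R y)" for k, OF intk] comb[of "\<lambda>_. F x", OF int0]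
        by (intro tendsto_intros lim)
      obtain d where d: "d > 0" "\<And>e. 0 < e \<Longrightarrow> e < d \<Longrightarrow>
          (LINT y|lebesgue. F (x + e *\<^sub>R y) (\<xi> + t *\<^sub>R J y) - (1 - t) * F (x + e *\<^sub>R y) \<xi>
             - t * F (x + e *\<^sub>R y) (\<xi> + J y)) \<le> 0"
        using blow_up_convexity[OF \<Omega> x int conv[OF _ _ t] sm K(1,3), of \<xi>] unfolding J_def by blast
      have "\<forall>\<^sub>F k in sequentially. \<epsilon> k < d" using \<epsilon>(2) d(1) by (intro order_tendstoD) auto
      then have "\<forall>\<^sub>F k in sequentially. (LINT y|lebesgue. F (x + \<epsilon> k *\<^sub>R y) (\<xi> + t *\<^sub>R J y) - (1 - t) * F (x + \<epsilon> k *\<^sub>R y) \<xi>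
            - t * F (x + \<epsilon> k *\<^sub>R y) (\<xi> + J y)) \<le> 0"
        by eventually_elim (intro d \<epsilon>)
      from tendsto_upperbound[OF tends this]
      show "(LINT y|lebesgue. F x (\<xi> + t *\<^sub>R Jac \<eta> y) - (1 - t) * F x \<xi> - t * F x (\<xi> + Jac \<eta> y)) \<le> 0"
        by (simp add: J_def)
    qed
  qed
qed

section \<open>From convexity of the functional to the two pointwise conclusions\<close>

lemma
  fixes u w :: "real^'n \<Rightarrow> real^'m"
  assumes u: "u \<in> C0_inf \<Omega>" and w: "w \<in> C0_inf \<Omega>"
  shows C0_inf_add_scaleR: "(\<lambda>x. u x + t *\<^sub>R w x) \<in> C0_inf \<Omega>"
    and Jac_add_scaleR: "Jac (\<lambda>x. u x + t *\<^sub>R w x) x = Jac u x + t *\<^sub>R Jac w x"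
proof -
  obtain K where K: "compact K" "K \<subseteq> \<Omega>" "\<And>x. x \<notin> K \<Longrightarrow> u x = 0" and smu: "\<And>k. Ck_fun k u"
    by (rule C0_infE[OF u], rule that)
  obtain L where L: "compact L" "L \<subseteq> \<Omega>" "\<And>x. x \<notin> L \<Longrightarrow> w x = 0" and smw: "\<And>k. Ck_fun k w"
    by (rule C0_infE[OF w], rule that)
  show "(\<lambda>x. u x + t *\<^sub>R w x) \<in> C0_inf \<Omega>"
  proof (rule C0_infI[where K = "K \<union> L"])
    show "Ck_fun k (\<lambda>x. u x + t *\<^sub>R w x)" for k
      by (rule Ck_fun_add[OF smu Ck_fun_bounded_linear[OF bounded_linear_scaleR_right smw]])
  qed (use K L in auto)
  show "Jac (\<lambda>x. u x + t *\<^sub>R w x) x = Jac u x + t *\<^sub>R Jac w x"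
  proof (rule Jac_eqI)
    have "((\<lambda>x. u x + t *\<^sub>R w x) has_derivative (\<lambda>h. Jac u x *v h + t *\<^sub>R (Jac w x *v h))) (at x)"
      by (intro has_derivative_add has_derivative_scaleR_right Jac_has_derivative smu smw)
    then show "((\<lambda>x. u x + t *\<^sub>R w x) has_derivative (\<lambda>h. (Jac u x + t *\<^sub>R Jac w x) *v h)) (at x)"
      by (simp add: matrix_vector_mult_add_rdistrib scaleR_matrix_vector_assoc)
  qed
qed

theorem proposition4p2:
  fixes \<Omega> :: "(real^'n) set"
    and f :: "real^'n \<Rightarrow> real^'n^'m \<Rightarrow> real"
    and c2 :: "real^'n \<Rightarrow> real"
    and c3 :: "real^'n^'m \<Rightarrow> real"
  assumes "open \<Omega>" and "connected \<Omega>" and "\<Omega> \<noteq> {}" and "bounded \<Omega>"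
    and "AE x in lebesgue_on \<Omega>. C1_fun (f x)"
    and "\<And>\<xi>. (\<lambda>x. f x \<xi>) \<in> borel_measurable (lebesgue_on \<Omega>)"
    and "integrable (lebesgue_on \<Omega>) (\<lambda>x. f x 0)"
    and "integrable (lebesgue_on \<Omega>) c2" and "AE x in lebesgue_on \<Omega>. 0 < c2 x"
    and "continuous_on UNIV c3" and "\<And>\<xi>. 0 < c3 \<xi>"
    and "AE x in lebesgue_on \<Omega>. \<forall>\<xi>. norm (A_of f x \<xi>) \<le> c2 x + c3 \<xi>"
    and "integral_convex \<Omega> f"
  shows "(AE x\<^sub>0 in lebesgue_on \<Omega>. quasimonotone (A_of f x\<^sub>0)) \<and>
         (AE x\<^sub>0 in lebesgue_on \<Omega>. quasiconvex \<Omega> (f x\<^sub>0))"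
proof -
  have S: "\<Omega> \<in> sets lebesgue" and lm: "\<Omega> \<in> lmeasurable"
    using assms(1,4) by (auto simp: lmeasurable_open)
  \<comment> \<open>Gathers what is known only almost everywhere. Setting \<open>F\<close> to zero
    at all other points makes continuity and the Lipschitz bound hold for every x, as the blow-up
    requires, without changing any integral.\<close>
  define good where "good x \<longleftrightarrow> x \<in> \<Omega> \<and> C1_fun (f x) \<and> (\<forall>\<xi>. norm (A_of f x \<xi>) \<le> c2 x + c3 \<xi>)" for x
  define F where "F x \<zeta> = (if good x then f x \<zeta> else 0)" for x \<zeta>
  define c where "c x = indicator \<Omega> x * c2 x" for x
  have AE_good: "AE x in lebesgue_on \<Omega>. good x"
    using assms(5,12) AE_space unfolding good_def by eventually_elim simp
  then have AE_F: "AE x in lebesgue_on \<Omega>. f x (Z x) = F x (Z x)" for Z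
    by eventually_elim (simp add: F_def)
  have F_off: "F x \<zeta> = 0" if "x \<notin> \<Omega>" for x \<zeta> using that by (simp add: F_def good_def)
  have c: "integrable lebesgue c"
    using assms(8) S by (subst (asm) integrable_restrict_space) (auto simp: c_def[abs_def])
  \<comment> \<open>The mean value inequality on a ball: the growth bound splits the Lipschitz
    constant into an integrable function of x and the maximum of the continuous \<open>c3\<close> on
    the ball.\<close>
  have lip: "\<exists>M\<ge>0. \<forall>x. \<forall>\<zeta>\<in>cball 0 R. \<forall>\<zeta>'\<in>cball 0 R.
                \<bar>F x \<zeta> - F x \<zeta>'\<bar> \<le> (\<bar>c x\<bar> + M) * norm (\<zeta> - \<zeta>')" for R
  proof -
    have "compact (c3 ` cball 0 R)"
      by (rule compact_continuous_image[OF continuous_on_subset[OF assms(10) subset_UNIV] compact_cball])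
    then have "bounded (c3 ` cball 0 R)" by (rule compact_imp_bounded)
    then obtain M where M: "0 < M" "\<forall>y\<in>c3 ` cball 0 R. norm y \<le> M" unfolding bounded_pos by blast
    have "\<bar>F x \<zeta> - F x \<zeta>'\<bar> \<le> (\<bar>c x\<bar> + M) * norm (\<zeta> - \<zeta>')" if "\<zeta> \<in> cball 0 R" "\<zeta>' \<in> cball 0 R" for x \<zeta> \<zeta>'
    proof (cases "good x")
      case True
      have "\<bar>f x \<zeta> - f x \<zeta>'\<bar> \<le> (\<bar>c x\<bar> + M) * norm (\<zeta> - \<zeta>')"
      proof (rule C1_fun_lipschitz[OF _ _ _ that])
        show "C1_fun (f x)" using True by (simp add: good_def)
        fix \<xi> :: "real^'n^'m" assume \<xi>: "\<xi> \<in> cball 0 R"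
        have "norm (gradient (f x) \<xi>) \<le> c2 x + c3 \<xi>" using True by (simp add: good_def A_of_def)
        also have "c2 x \<le> \<bar>c x\<bar>" using True by (simp add: good_def c_def)
        also have "c3 \<xi> \<le> M" using bspec[OF M(2) imageI[OF \<xi>]] by simp
        finally show "norm (gradient (f x) \<xi>) \<le> \<bar>c x\<bar> + M" by simp
      qed (rule convex_cball)
      then show ?thesis using True by (simp add: F_def)
    next
      case False
      then show ?thesis using M(1) by (simp add: F_def)
    qed
    then show ?thesis using M(1) by (intro exI[of _ M]) auto
  qed
  have cont: "continuous_on UNIV (F x)" for x
  proof (cases "good x")
    case True
    then have "F x = f x" by (simp add: F_def fun_eq_iff)
    then show ?thesis using True by (simp add: good_def C1_fun_continuous)
  next
    case False
    then have "F x = (\<lambda>_. 0)" by (simp add: F_def fun_eq_iff)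
    then show ?thesis by simp
  qed
  have F_if: "(\<lambda>x. if x \<in> \<Omega> then F x (Z x) else 0) = (\<lambda>x. F x (Z x))" for Z
    using F_off by (auto simp: fun_eq_iff)
  have meas: "(\<lambda>x. F x \<zeta>) \<in> borel_measurable lebesgue" for \<zeta>
  proof -
    have "(\<lambda>x. F x \<zeta>) \<in> borel_measurable (lebesgue_on \<Omega>)"
      by (rule AE_lebesgue_measurable_cong[OF assms(6) AE_F S])
    from borel_measurable_if_I[OF this S] show ?thesis unfolding F_if .
  qed
  have F0: "integrable lebesgue (\<lambda>x. F x 0)"
  proof -
    have "integrable (lebesgue_on \<Omega>) (\<lambda>x. F x 0)"
      by (rule integrable_cong_AE_imp[OF assms(7) measurable_restrict_space1[OF meas] AE_F])
    then have "integrable lebesgue (\<lambda>x. indicator \<Omega> x *\<^sub>R F x 0)"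
      using S by (subst (asm) integrable_restrict_space) auto
    also have "(\<lambda>x. indicator \<Omega> x *\<^sub>R F x 0) = (\<lambda>x. F x 0)"
      using F_off by (auto simp: fun_eq_iff indicator_def)
    finally show ?thesis .
  qed
  have measZ: "(\<lambda>x. F x (Z x)) \<in> borel_measurable lebesgue" if "continuous_on UNIV Z" for Z
    by (rule borel_measurable_caratheodory[OF meas cont])
       (use that in \<open>simp add: borel_measurable_continuous_onI measurable_completion\<close>)
  have int: "integrable lebesgue (\<lambda>x. F x (Z x))" if Z: "continuous_on UNIV Z" "bounded (range Z)" for Z
  proof -
    obtain R where R: "0 < R" "\<And>x. norm (Z x) \<le> R"
      using Z(2) unfolding bounded_pos by blast
    obtain M where M: "0 \<le> M" "\<And>x \<zeta> \<zeta>'. \<zeta> \<in> cball 0 R \<Longrightarrow> \<zeta>' \<in> cball 0 R \<Longrightarrow>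
                \<bar>F x \<zeta> - F x \<zeta>'\<bar> \<le> (\<bar>c x\<bar> + M) * norm (\<zeta> - \<zeta>')"
      using lip[of R] by blast
    show ?thesis
    proof (rule Bochner_Integration.integrable_bound[OF _ measZ[OF Z(1)]])
      \<comment> \<open>The dominating function is |F x 0| plus the Lipschitz growth up to radius
        \<open>R\<close>. Its constant part is integrable because the bounded set \<Omega> has
        finite measure.\<close>
      have "integrable lebesgue (indicat_real \<Omega>)"
        by (rule lmeasurable_iff_integrable[THEN iffD1, OF lm])
      then show "integrable lebesgue (\<lambda>x. \<bar>F x 0\<bar> + (\<bar>c x\<bar> + M * indicator \<Omega> x) * R)"
        using F0 c by simp
      show "AE x in lebesgue. norm (F x (Z x)) \<le> norm (\<bar>F x 0\<bar> + (\<bar>c x\<bar> + M * indicator \<Omega> x) * R)"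
      proof (rule AE_I2)
        fix x
        show "norm (F x (Z x)) \<le> norm (\<bar>F x 0\<bar> + (\<bar>c x\<bar> + M * indicator \<Omega> x) * R)"
        proof (cases "x \<in> \<Omega>")
          case True
          have "\<bar>F x (Z x) - F x 0\<bar> \<le> (\<bar>c x\<bar> + M) * norm (Z x - 0)"
            using R by (intro M(2)) auto
          also have "\<dots> \<le> (\<bar>c x\<bar> + M) * R" using R(2)[of x] M(1) by (intro mult_left_mono) auto
          finally show ?thesis using True by simp
        qed (simp add: F_off)
      qed
    qed
  qed
  \<comment> \<open>On test functions the functional sees neither the choice of the weak Jacobian
    nor the modification of f on a null set.\<close>
  have F_eq: "F_functional \<Omega> f \<phi> = (LINT x|lebesgue. F x (Jac \<phi> x))" if \<phi>: "\<phi> \<in> C0_inf \<Omega>"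
    for \<phi> :: "real^'n \<Rightarrow> real^'m"
  proof -
    have sm: "\<And>k. Ck_fun k \<phi>" using \<phi> by (simp add: C0_inf_def)
    have mF: "(\<lambda>x. F x (Jac \<phi> x)) \<in> borel_measurable (lebesgue_on \<Omega>)"
      by (rule measurable_restrict_space1[OF measZ[OF continuous_on_Jac[OF sm]]])
    have AE: "AE x in lebesgue_on \<Omega>. F x (Jac \<phi> x) = f x (Jac \<phi> x)"
      using AE_F[of "Jac \<phi>"] by eventually_elim simp
    have mf: "(\<lambda>x. f x (Jac \<phi> x)) \<in> borel_measurable (lebesgue_on \<Omega>)"
      by (rule AE_lebesgue_measurable_cong[OF mF AE S])
    have "F_functional \<Omega> f \<phi> = (LINT x|lebesgue_on \<Omega>. f x (Jac \<phi> x))"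
      by (rule F_functional_C0_inf[where f = f, OF assms(1) \<phi> mf])
    also have "\<dots> = (LINT x|lebesgue_on \<Omega>. F x (Jac \<phi> x))"
      by (rule integral_cong_AE[OF mf mF AE_F])
    also have "\<dots> = (LINT x|lebesgue. F x (Jac \<phi> x))"
      by (rule integral_lebesgue_on_eq[OF S F_off])
    finally show ?thesis .
  qed
  have conv: "(LINT x|lebesgue. F x (Jac u x + t *\<^sub>R Jac w x))
        \<le> (1 - t) * (LINT x|lebesgue. F x (Jac u x)) + t * (LINT x|lebesgue. F x (Jac u x + Jac w x))"
    if u: "u \<in> C0_inf \<Omega>" and w: "w \<in> C0_inf \<Omega>" and t: "0 \<le> t" "t \<le> 1" for u w :: "real^'n \<Rightarrow> real^'m" and t
  proof -
    \<comment> \<open>The endpoint u + w of the segment, with the factor 1 kept so that the rules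
      for \<open>u x + t *\<^sub>R w x\<close> apply to it as well.\<close>
    define v where "v x = u x + 1 *\<^sub>R w x" for x
    have v: "v \<in> C0_inf \<Omega>" unfolding v_def by (rule C0_inf_add_scaleR[OF u w])
    have Jv: "Jac v x = Jac u x + Jac w x" for x
      unfolding v_def using Jac_add_scaleR[OF u w, of 1 x] by simp
    have "F_functional \<Omega> f (\<lambda>x. (1 - t) *\<^sub>R u x + t *\<^sub>R v x) \<le> (1 - t) * F_functional \<Omega> f u + t * F_functional \<Omega> f v"
      using assms(13) t C0_inf_subset_W0_1_inf[OF assms(1) u] C0_inf_subset_W0_1_inf[OF assms(1) v]
      unfolding integral_convex_def by simp
    also have "(\<lambda>x. (1 - t) *\<^sub>R u x + t *\<^sub>R v x) = (\<lambda>x. u x + t *\<^sub>R w x)"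
      by (simp add: v_def fun_eq_iff algebra_simps)
    finally show ?thesis
      unfolding F_eq[OF u] F_eq[OF v] F_eq[OF C0_inf_add_scaleR[OF u w]] Jac_add_scaleR[OF u w] Jv .
  qed
  have "AE x in lebesgue. x \<in> \<Omega> \<longrightarrow> (\<forall>G \<xi> t. \<forall>\<eta>\<in>C0_inf G. 0 \<le> t \<and> t \<le> 1 \<longrightarrow>
      (LINT y|lebesgue. F x (\<xi> + t *\<^sub>R Jac \<eta> y) - (1 - t) * F x \<xi> - t * F x (\<xi> + Jac \<eta> y)) \<le> 0)"
    by (rule AE_segment_convexity[OF assms(1) c _ cont int conv]) (use lip in blast)
  then have AE: "AE x in lebesgue_on \<Omega>. \<forall>G \<xi> t. \<forall>\<eta>\<in>C0_inf G. 0 \<le> t \<and> t \<le> 1 \<longrightarrow>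
      (LINT y|lebesgue. F x (\<xi> + t *\<^sub>R Jac \<eta> y) - (1 - t) * F x \<xi> - t * F x (\<xi> + Jac \<eta> y)) \<le> 0"
    using S by (subst AE_restrict_space_iff) auto
  have "AE x in lebesgue_on \<Omega>. quasimonotone (A_of f x) \<and> quasiconvex \<Omega> (f x)"
    using AE AE_good
  proof eventually_elim
    case (elim x)
    have h: "C1_fun (f x)" and Fx: "\<And>\<zeta>. F x \<zeta> = f x \<zeta>"
      using elim(2) by (auto simp: good_def F_def)
    have key: "0 \<le> (LINT y|lebesgue. f x (\<xi> + Jac \<eta> y) - f x \<xi>)"
      "0 \<le> (LINT y|lebesgue. gradient (f x) (\<xi> + Jac \<eta> y) \<bullet> Jac \<eta> y)"
      if \<eta>: "\<eta> \<in> C0_inf G" for \<eta> :: "real^'n \<Rightarrow> real^'m" and G \<xi>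
    proof -
      obtain K where K: "compact K" "K \<subseteq> G" "\<And>x. x \<notin> K \<Longrightarrow> \<eta> x = 0" and sm: "\<And>k. Ck_fun k \<eta>"
        by (rule C0_infE[OF \<eta>], rule that)
      have seg: "(LINT y|lebesgue. f x (\<xi> + t *\<^sub>R Jac \<eta> y) - (1 - t) * f x \<xi> - t * f x (\<xi> + Jac \<eta> y)) \<le> 0"
        if "0 \<le> t" "t \<le> 1" for t
        using elim(1) \<eta> that unfolding Fx by blast
      show "0 \<le> (LINT y|lebesgue. f x (\<xi> + Jac \<eta> y) - f x \<xi>)"
        by (intro segment_convexity_imp_monotonicity(1)[of "f x" \<eta> K \<xi>] h sm K seg)
      show "0 \<le> (LINT y|lebesgue. gradient (f x) (\<xi> + Jac \<eta> y) \<bullet> Jac \<eta> y)"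
        by (intro segment_convexity_imp_monotonicity(2)[of "f x" \<eta> K \<xi>] h sm K seg)
    qed
    have Joff: "Jac \<eta> y = 0" if \<eta>: "\<eta> \<in> C0_inf G" and y: "y \<notin> G" for \<eta> :: "real^'n \<Rightarrow> real^'m" and G y
    proof -
      obtain K where K: "compact K" "K \<subseteq> G" "\<And>x. x \<notin> K \<Longrightarrow> \<eta> x = 0"
        by (rule C0_infE[OF \<eta>], rule that)
      show ?thesis by (rule Jac_eq_0_outside[OF K(1,3) contra_subsetD[OF K(2) y]])
    qed
    have "quasimonotone (A_of f x)"
      unfolding quasimonotone_def
    proof (intro allI impI ballI)
      fix G :: "(real^'n) set" and \<xi> and \<eta> :: "real^'n \<Rightarrow> real^'m"
      assume G: "open G \<and> bounded G \<and> G \<noteq> {}" and \<eta>: "\<eta> \<in> C0_inf G"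
      have "(LINT y|lebesgue_on G. A_of f x (\<xi> + Jac \<eta> y) \<bullet> Jac \<eta> y)
          = (LINT y|lebesgue. gradient (f x) (\<xi> + Jac \<eta> y) \<bullet> Jac \<eta> y)"
        unfolding A_of_def using G by (intro integral_lebesgue_on_eq) (auto simp: Joff[OF \<eta>])
      then show "0 \<le> (LINT y|lebesgue_on G. A_of f x (\<xi> + Jac \<eta> y) \<bullet> Jac \<eta> y)"
        using key(2)[OF \<eta>] by simp
    qed
    moreover have "quasiconvex \<Omega> (f x)"
      unfolding quasiconvex_def
    proof (intro allI ballI)
      fix \<xi> and \<eta> :: "real^'n \<Rightarrow> real^'m"
      assume \<eta>: "\<eta> \<in> C0_inf \<Omega>"
      obtain K where K: "compact K" "K \<subseteq> \<Omega>" "\<And>x. x \<notin> K \<Longrightarrow> \<eta> x = 0" and sm: "\<And>k. Ck_fun k \<eta>"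
        by (rule C0_infE[OF \<eta>], rule that)
      have "continuous_on UNIV (\<lambda>y. f x (\<xi> + Jac \<eta> y) - f x \<xi>)"
        by (intro continuous_on_diff continuous_on_const continuous_on_compose2[OF C1_fun_continuous[OF h]]
            continuous_on_add continuous_on_Jac sm) simp
      then have int': "integrable (lebesgue_on \<Omega>) (\<lambda>y. f x (\<xi> + Jac \<eta> y) - f x \<xi>)"
        by (intro integrable_lebesgue_onI[OF S] integrable_continuous_compact_support[OF _ K(1)])
           (simp_all add: Jac_eq_0_outside[OF K(1,3)])
      \<comment> \<open>On \<Omega> the constant f(x, \<xi>) is integrable, so it can be separated
        from the compactly supported difference, whose integral is nonnegative.\<close>
      interpret finite_measure "lebesgue_on \<Omega>" by (rule finite_measure_lebesgue_on[OF lm])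
      have "f x \<xi> * measure lebesgue \<Omega> + 0 \<le> (LINT y|lebesgue_on \<Omega>. f x \<xi>) + (LINT y|lebesgue. f x (\<xi> + Jac \<eta> y) - f x \<xi>)"
        using key(1)[OF \<eta>] S by (intro add_mono) (simp_all add: measure_restrict_space)
      also have "(LINT y|lebesgue. f x (\<xi> + Jac \<eta> y) - f x \<xi>) = (LINT y|lebesgue_on \<Omega>. f x (\<xi> + Jac \<eta> y) - f x \<xi>)"
        by (rule integral_lebesgue_on_eq[symmetric, OF S]) (simp add: Joff[OF \<eta>])
      also have "(LINT y|lebesgue_on \<Omega>. f x \<xi>) + \<dots> = (LINT y|lebesgue_on \<Omega>. f x \<xi> + (f x (\<xi> + Jac \<eta> y) - f x \<xi>))"
        by (rule Bochner_Integration.integral_add[symmetric, OF _ int']) simp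
      finally show "(LINT x'|lebesgue_on \<Omega>. f x (\<xi> + Jac \<eta> x')) \<ge> f x \<xi> * measure lebesgue \<Omega>"
        by simp
    qed
    ultimately show ?case ..
  qed
  then show ?thesis by simp
qed

end
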